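(* Let $(\mathcal E,\mathcal F,\Phi)$ be a functional calculus on a complex Banach space $X$, $\mathcal F$ an algebra of functions on a set $O$. Let $H,K$ be complex Hilbert spaces and $T:K\to H$ a bounded linear operator. a) If $g\in\mathcal F(O;H')$, then $T'\circ g\in\mathcal F(O;K')$, $\operatorname{dom}(\Phi_\gamma(g))\subseteq\operatorname{dom}(\Phi_\gamma(T'\circ g))$ and $$\Phi_\gamma(T'\circ g)x=\Phi_\gamma(g)x\circ T\qquad\text{for all }x\in\operatorname{dom}(\Phi_\gamma(g)).$$ In particular, the square function $\Phi_\gamma(T'\circ g)$ is subordinate to $\Phi_\gamma(g)$. b) If $f\in\mathcal F(O;K)$, then $T\circ f\in\mathcal F(O;H)$, $\operatorname{dom}(\Phi_{\gamma'}(f))\subseteq\operatorname{dom}(\Phi_{\gamma'}(T\circ f))$ and $$\Phi_{\gamma'}(T\circ f)x'=\Phi_{\gamma'}(f)x'\circ T'\qquad\text{for all }x'\in\operatorname{dom}(\Phi_{\gamma'}(f)).$$ In particular, the dual square function $\Phi_{\gamma'}(T\circ f)$ is subordinate to $\Phi_{\gamma'}(f)$.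
   Context: Functional calculus: $O$ is a nonempty set, $\mathcal F$ a unital algebra of scalar functions on $O$, $\mathcal E\subseteq\mathcal F$ a subalgebra, $\Phi:\mathcal E\to\mathcal L(X)$ an algebra homomorphism. Every $f\in\mathcal F$ is assumed regularisable, i.e. there is $e\in\mathcal E$ with $ef\in\mathcal E$ and $\Phi(e)$ injective; then $\Phi(f):=\Phi(e)^{-1}\Phi(ef)$ with natural domain (independent of $e$). $\gamma$-norms: for linear $S:H\to X$ put $\|S\|_\gamma=\sup_F\big(\mathbb E\|\sum_{e\in F}\gamma_e\,Se\|_X^2\big)^{1/2}$, supremum over finite orthonormal systems $F\subseteq H$, $(\gamma_e)$ independent complex standard Gaussians. $\gamma(H;X)$ is the closure of the finite rank operators in $\{S:\|S\|_\gamma<\infty\}$. For $V\in\mathcal L(H';X')$, $\|V\|_{\gamma'}=\sup|\operatorname{tr}(V'U)|$ over finite rank $U:H\to X$ with $\|U\|_\gamma\le1$, where $\operatorname{tr}(V'U)=\sum_j\langle x_j,Vg_j'\rangle$ if $U=\sum_jg_j'\otimes x_j$; $\gamma'(H';X')=\{V:\|V\|_{\gamma'}<\infty\}$. For $f:O\to H'$ and $h\in H$ let $(h\diamond f)(z)=\langle h,f(z)\rangle_{H,H'}$; $\mathcal F(O;H')$ is the set of $f:O\to H'$ with $h\diamond f\in\mathcal F$ for all $h\in H$. For $f:O\to H$ and $h'\in H'$ let $(f\diamond h')(z)=\langle f(z),h'\rangle_{H,H'}$; $\mathcal F(O;H)$ is the set of $f:O\to H$ with $f\diamond h'\in\mathcal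 F$ for all $h'\in H'$. For $f\in\mathcal F(O;H')$: $\operatorname{dom}(\Phi_\gamma(f))$ is the set of $x\in X$ with $x\in\operatorname{dom}(\Phi(h\diamond f))$ for all $h\in H$ and $(h\mapsto\Phi(h\diamond f)x)\in\gamma(H;X)$, and $[\Phi_\gamma(f)x]h:=\Phi(h\diamond f)x$. For $f\in\mathcal F(O;H)$: $\operatorname{dom}(\Phi_{\gamma'}(f))$ is the set of $x'\in X'$ with $x'\in\operatorname{dom}(\Phi(f\diamond h')')$ for all $h'\in H'$ and $(h'\mapsto\Phi(f\diamond h')'x')\in\gamma'(H';X')$, and $[\Phi_{\gamma'}(f)x']h':=\Phi(f\diamond h')'x'$; here it is a standing assumption that $\Phi(f\diamond h')$ is densely defined for each $h'$. Subordination: an operator (square function) $Q:\operatorname{dom}(Q)\to\gamma(K;X)$ is subordinate to $R:\operatorname{dom}(R)\to\gamma(H;X)$ (with $\operatorname{dom}(Q),\operatorname{dom}(R)\subseteq X$) if $\operatorname{dom}(R)\subseteq\operatorname{dom}(Q)$ and there is a bounded $T:K\to H$ with $Qx=Rx\circ T$ for all $x\in\operatorname{dom}(R)$. Analogously, a dual square function $Q:\operatorname{dom}(Q)\to\gamma'(H';X')$ is subordinate to $R:\operatorname{dom}(R)\to\gamma'(K';X')$ (domains in $X'$) if $\operatorname{dom}(R)\subseteq\operatorname{dom}(Q)$ and there is a bounded $S:H'\to K'$ with $Qx'=Rx'\circ S$ for all $x'\in\operatorname{dom}(R)$. *)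

theory Defs
  imports "HOL-Probability.Probability"
begin

section \<open>Complex Banach and Hilbert spaces\<close>

class complex_vector = real_vector +
  fixes scaleC :: "complex \<Rightarrow> 'a \<Rightarrow> 'a" (infixr \<open>*\<^sub>C\<close> 75)
  assumes scaleC_add_right: "c *\<^sub>C (x + y) = c *\<^sub>C x + c *\<^sub>C y"
    and scaleC_add_left: "(c + d) *\<^sub>C x = c *\<^sub>C x + d *\<^sub>C x"
    and scaleC_scaleC: "c *\<^sub>C d *\<^sub>C x = (c * d) *\<^sub>C x"
    and scaleC_of_real: "complex_of_real r *\<^sub>C x = r *\<^sub>R x"

class complex_normed_vector = complex_vector + real_normed_vector +
  assumes norm_scaleC: "norm (c *\<^sub>C x) = cmod c * norm x"

class cbanach = complex_normed_vector + complete_space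

text \<open>The inner product is linear in its first argument; positivity is contained in
  \<open>cinner_norm\<close>.\<close>

class complex_inner = complex_normed_vector +
  fixes cinner :: "'a \<Rightarrow> 'a \<Rightarrow> complex"
  assumes cinner_commute: "cinner x y = cnj (cinner y x)"
    and cinner_add_left: "cinner (x + y) z = cinner x z + cinner y z"
    and cinner_scaleC_left: "cinner (c *\<^sub>C x) y = c * cinner x y"
    and cinner_norm: "cinner x x = complex_of_real ((norm x)\<^sup>2)"

class chilbert_space = complex_inner + complete_space

instantiation complex :: chilbert_space
begin

definition scaleC_complex :: "complex \<Rightarrow> complex \<Rightarrow> complex"
  where "scaleC_complex c x = c * x"

definition cinner_complex :: "complex \<Rightarrow> complex \<Rightarrow> complex"
  where "cinner_complex x y = x * cnj y"

instance
  by standard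
    (simp_all add: scaleC_complex_def cinner_complex_def algebra_simps norm_mult scaleR_conv_of_real
      complex_norm_square[symmetric])

end

lemma scaleC_zero_right [simp]: "c *\<^sub>C (0::'a::complex_vector) = 0"
  using scaleC_add_right[of c 0 "0::'a"] by simp

lemma scaleC_minus_right: "c *\<^sub>C (- x) = - (c *\<^sub>C (x::'a::complex_vector))"
  using scaleC_add_right[of c x "- x"] by (simp add: eq_neg_iff_add_eq_0 add.commute)

lemma scaleC_diff_right: "c *\<^sub>C (x - y) = c *\<^sub>C x - c *\<^sub>C (y::'a::complex_vector)"
  using scaleC_add_right[of c x "- y"] by (simp add: scaleC_minus_right)

lemma scaleC_scaleR: "c *\<^sub>C r *\<^sub>R x = r *\<^sub>R c *\<^sub>C (x::'a::complex_vector)"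
  by (simp add: scaleC_of_real[symmetric] scaleC_scaleC mult.commute)

definition clinear :: "('a::complex_vector \<Rightarrow> 'b::complex_vector) \<Rightarrow> bool"
  where "clinear f \<longleftrightarrow> (\<forall>x y. f (x + y) = f x + f y) \<and> (\<forall>c x. f (c *\<^sub>C x) = c *\<^sub>C f x)"

definition bounded_clinear :: "('a::complex_normed_vector \<Rightarrow> 'b::complex_normed_vector) \<Rightarrow> bool"
  where "bounded_clinear f \<longleftrightarrow> clinear f \<and> (\<exists>B. \<forall>x. norm (f x) \<le> B * norm x)"

lemma bounded_clinear_imp_bounded_linear:
  assumes "bounded_clinear f"
  shows "bounded_linear f"
proof -
  obtain B where B: "\<And>x. norm (f x) \<le> B * norm x"
    using assms by (auto simp: bounded_clinear_def)
  show ?thesis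
  proof (rule bounded_linear_intro)
    show "f (x + y) = f x + f y" for x y
      using assms by (simp add: bounded_clinear_def clinear_def)
    show "f (r *\<^sub>R x) = r *\<^sub>R f x" for r x
      using assms by (metis bounded_clinear_def clinear_def scaleC_of_real)
    show "norm (f x) \<le> norm x * B" for x
      using B[of x] by (simp add: mult.commute)
  qed
qed

lemma bounded_clinear_iff:
  "bounded_clinear f \<longleftrightarrow> bounded_linear f \<and> (\<forall>c x. f (c *\<^sub>C x) = c *\<^sub>C f x)"
proof
  assume "bounded_clinear f"
  then show "bounded_linear f \<and> (\<forall>c x. f (c *\<^sub>C x) = c *\<^sub>C f x)"
    using bounded_clinear_imp_bounded_linear by (auto simp: bounded_clinear_def clinear_def)
next
  assume *: "bounded_linear f \<and> (\<forall>c x. f (c *\<^sub>C x) = c *\<^sub>C f x)"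
  then interpret bounded_linear f by simp
  from bounded obtain K where "\<And>x. norm (f x) \<le> norm x * K" by blast
  then have "\<exists>B. \<forall>x. norm (f x) \<le> B * norm x" by (metis mult.commute)
  then show "bounded_clinear f" using * by (simp add: bounded_clinear_def clinear_def add)
qed

typedef (overloaded) ('a, 'b) cblinfun (\<open>(_ \<Rightarrow>\<^sub>C\<^sub>L /_)\<close> [22, 21] 21) =
  "{f :: 'a::complex_normed_vector \<Rightarrow> 'b::complex_normed_vector. bounded_clinear f}"
  morphisms cblinfun_apply Cblinfun
  by (rule exI[of _ "\<lambda>_. 0"]) (simp add: bounded_clinear_iff)

notation cblinfun_apply (infixr \<open>*\<^sub>V\<close> 70)

setup_lifting type_definition_cblinfun

lemma cblinfun_eqI: "(\<And>x. f *\<^sub>V x = g *\<^sub>V x) \<Longrightarrow> f = g"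
  by transfer auto

lemma bounded_clinear_cblinfun_apply: "bounded_clinear (cblinfun_apply f)"
  using cblinfun_apply by blast

instantiation cblinfun :: (complex_normed_vector, complex_normed_vector) complex_normed_vector
begin

lift_definition norm_cblinfun :: "'a \<Rightarrow>\<^sub>C\<^sub>L 'b \<Rightarrow> real" is onorm .

lift_definition zero_cblinfun :: "'a \<Rightarrow>\<^sub>C\<^sub>L 'b" is "\<lambda>_. 0"
  by (simp add: bounded_clinear_iff)

lift_definition plus_cblinfun :: "'a \<Rightarrow>\<^sub>C\<^sub>L 'b \<Rightarrow> 'a \<Rightarrow>\<^sub>C\<^sub>L 'b \<Rightarrow> 'a \<Rightarrow>\<^sub>C\<^sub>L 'b"
  is "\<lambda>f g x. f x + g x"
  by (simp add: bounded_clinear_iff bounded_linear_add scaleC_add_right)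

lift_definition minus_cblinfun :: "'a \<Rightarrow>\<^sub>C\<^sub>L 'b \<Rightarrow> 'a \<Rightarrow>\<^sub>C\<^sub>L 'b \<Rightarrow> 'a \<Rightarrow>\<^sub>C\<^sub>L 'b"
  is "\<lambda>f g x. f x - g x"
  by (simp add: bounded_clinear_iff bounded_linear_sub scaleC_diff_right)

lift_definition uminus_cblinfun :: "'a \<Rightarrow>\<^sub>C\<^sub>L 'b \<Rightarrow> 'a \<Rightarrow>\<^sub>C\<^sub>L 'b" is "\<lambda>f x. - f x"
  by (simp add: bounded_clinear_iff bounded_linear_minus scaleC_minus_right)

lift_definition scaleR_cblinfun :: "real \<Rightarrow> 'a \<Rightarrow>\<^sub>C\<^sub>L 'b \<Rightarrow> 'a \<Rightarrow>\<^sub>C\<^sub>L 'b"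
  is "\<lambda>r f x. r *\<^sub>R f x"
  by (simp add: bounded_clinear_iff bounded_linear_compose[OF bounded_linear_scaleR_right]
      scaleC_scaleR)

lift_definition scaleC_cblinfun :: "complex \<Rightarrow> 'a \<Rightarrow>\<^sub>C\<^sub>L 'b \<Rightarrow> 'a \<Rightarrow>\<^sub>C\<^sub>L 'b"
  is "\<lambda>c f x. c *\<^sub>C f x"
proof -
  fix c :: complex and f :: "'a \<Rightarrow> 'b"
  assume f: "bounded_clinear f"
  then obtain B where "\<And>x. norm (f x) \<le> B * norm x" by (auto simp: bounded_clinear_def)
  then have "\<And>x. norm (c *\<^sub>C f x) \<le> (cmod c * B) * norm x"
    by (simp add: norm_scaleC mult.assoc mult_left_mono)
  then show "bounded_clinear (\<lambda>x. c *\<^sub>C f x)"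
    using f unfolding bounded_clinear_def clinear_def
    by (simp add: scaleC_add_right scaleC_scaleC mult.commute[of c]) blast
qed

definition dist_cblinfun :: "'a \<Rightarrow>\<^sub>C\<^sub>L 'b \<Rightarrow> 'a \<Rightarrow>\<^sub>C\<^sub>L 'b \<Rightarrow> real"
  where "dist_cblinfun a b = norm (a - b)"

definition sgn_cblinfun :: "'a \<Rightarrow>\<^sub>C\<^sub>L 'b \<Rightarrow> 'a \<Rightarrow>\<^sub>C\<^sub>L 'b"
  where "sgn_cblinfun x = scaleR (inverse (norm x)) x"

definition uniformity_cblinfun :: "(('a \<Rightarrow>\<^sub>C\<^sub>L 'b) \<times> ('a \<Rightarrow>\<^sub>C\<^sub>L 'b)) filter"
  where "uniformity_cblinfun = (INF e\<in>{0 <..}. principal {(x, y). dist x y < e})"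

definition open_cblinfun :: "('a \<Rightarrow>\<^sub>C\<^sub>L 'b) set \<Rightarrow> bool"
  where "open_cblinfun S = (\<forall>x\<in>S. \<forall>\<^sub>F (x', y) in uniformity. x' = x \<longrightarrow> y \<in> S)"

instance
proof
  fix a b c :: "'a \<Rightarrow>\<^sub>C\<^sub>L 'b" and r s :: real and u v :: complex
  show "a + b + c = a + (b + c)" "a + b = b + a" "0 + a = a" "- a + a = 0" "a - b = a + - b"
    by (transfer, force)+
  show "r *\<^sub>R (a + b) = r *\<^sub>R a + r *\<^sub>R b" "(r + s) *\<^sub>R a = r *\<^sub>R a + s *\<^sub>R a"
    "r *\<^sub>R s *\<^sub>R a = (r * s) *\<^sub>R a" "1 *\<^sub>R a = a"
    by (transfer, force simp: algebra_simps)+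
  show "u *\<^sub>C (a + b) = u *\<^sub>C a + u *\<^sub>C b" "(u + v) *\<^sub>C a = u *\<^sub>C a + v *\<^sub>C a"
    "u *\<^sub>C v *\<^sub>C a = (u * v) *\<^sub>C a" "complex_of_real r *\<^sub>C a = r *\<^sub>R a"
    by (transfer, force simp: scaleC_add_right scaleC_add_left scaleC_scaleC scaleC_of_real)+
  show "dist a b = norm (a - b)" by (rule dist_cblinfun_def)
  show "sgn a = inverse (norm a) *\<^sub>R a" by (rule sgn_cblinfun_def)
  show "uniformity = (INF e\<in>{0 <..}. principal {(x, y :: 'a \<Rightarrow>\<^sub>C\<^sub>L 'b). dist x y < e})"
    by (rule uniformity_cblinfun_def)
  show "open U = (\<forall>x\<in>U. \<forall>\<^sub>F (x', y) in uniformity. x' = x \<longrightarrow> y \<in> U)" for U :: "('a \<Rightarrow>\<^sub>C\<^sub>L 'b) set"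
    by (rule open_cblinfun_def)
  show "(norm a = 0) = (a = 0)"
    by transfer (auto simp: onorm_eq_0 bounded_clinear_iff)
  show "norm (a + b) \<le> norm a + norm b"
    by transfer (simp add: onorm_triangle bounded_clinear_iff)
  show "norm (r *\<^sub>R a) = \<bar>r\<bar> * norm a"
    by transfer (simp add: onorm_scaleR bounded_clinear_iff)
  show "norm (u *\<^sub>C a) = cmod u * norm a"
  proof transfer
    fix c :: complex and f :: "'a \<Rightarrow> 'b"
    assume f: "bounded_clinear f"
    have "onorm (\<lambda>x. c *\<^sub>C f x) = onorm (\<lambda>x. cmod c *\<^sub>R f x)"
      by (simp add: onorm_def norm_scaleC)
    then show "onorm (\<lambda>x. c *\<^sub>C f x) = cmod c * onorm f"
      using f by (simp add: onorm_scaleR bounded_clinear_iff)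
  qed
qed

end

text \<open>The Banach space dual. The duality pairing is the bilinear evaluation
  \<open>\<langle>x, x'\<rangle> = x' *\<^sub>V x\<close>; in particular \<open>H'\<close> is not identified with \<open>H\<close>.\<close>

type_synonym 'a cdual = "('a, complex) cblinfun"

lemma norm_cblinfun: "norm (f *\<^sub>V x) \<le> norm f * norm x"
  by transfer (simp add: onorm bounded_clinear_iff)

lemma norm_cblinfun_bound: "0 \<le> b \<Longrightarrow> (\<And>x. norm (f *\<^sub>V x) \<le> b * norm x) \<Longrightarrow> norm f \<le> b"
  by transfer (rule onorm_bound)

lift_definition cblinfun_compose ::
    "('b::complex_normed_vector \<Rightarrow>\<^sub>C\<^sub>L 'c::complex_normed_vector) \<Rightarrow>
      ('a::complex_normed_vector \<Rightarrow>\<^sub>C\<^sub>L 'b) \<Rightarrow> 'a \<Rightarrow>\<^sub>C\<^sub>L 'c"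
  is "\<lambda>f g x. f (g x)"
  by (simp add: bounded_clinear_iff bounded_linear_compose)

lemma norm_cblinfun_compose: "norm (cblinfun_compose f g) \<le> norm f * norm g"
proof (rule norm_cblinfun_bound)
  fix x
  have "norm (f *\<^sub>V g *\<^sub>V x) \<le> norm f * (norm g * norm x)"
    by (rule order_trans[OF norm_cblinfun]) (simp add: mult_left_mono norm_cblinfun)
  then show "norm (cblinfun_compose f g *\<^sub>V x) \<le> norm f * norm g * norm x"
    by (simp add: cblinfun_compose.rep_eq mult.assoc)
qed simp

text \<open>The Banach space transpose \<open>T'y' = y' \<circ> T\<close>.\<close>

definition transpose_op ::
    "('a::complex_normed_vector \<Rightarrow>\<^sub>C\<^sub>L 'b::complex_normed_vector) \<Rightarrow> 'b cdual \<Rightarrow>\<^sub>C\<^sub>L 'a cdual"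
  where "transpose_op T = Cblinfun (\<lambda>y'. cblinfun_compose y' T)"

lemma transpose_op_apply [simp]: "transpose_op T *\<^sub>V y' = cblinfun_compose y' T"
proof -
  have "bounded_clinear (\<lambda>y'. cblinfun_compose y' T :: 'a cdual)"
    unfolding bounded_clinear_def clinear_def
  proof (intro conjI allI exI)
    show "cblinfun_compose (x + y) T = cblinfun_compose x T + cblinfun_compose y T" for x y :: "'b cdual"
      by transfer simp
    show "cblinfun_compose (c *\<^sub>C x) T = c *\<^sub>C cblinfun_compose x T" for c and x :: "'b cdual"
      by transfer simp
    show "norm (cblinfun_compose x T) \<le> norm T * norm x" for x :: "'b cdual"
      using norm_cblinfun_compose[of x T] by (simp add: mult.commute)
  qed
  then show ?thesis by (simp add: transpose_op_def Cblinfun_inverse)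
qed

section \<open>Functional calculus\<close>

text \<open>Possibly unbounded operators are partial functions, with the library's \<^const>\<open>dom\<close> as
  domain. The set \<open>O\<close> is the (nonempty) carrier of the type \<open>'o\<close>.\<close>

definition function_algebra :: "('o \<Rightarrow> complex) set \<Rightarrow> bool"
  where "function_algebra A \<longleftrightarrow>
    (\<lambda>_. 0) \<in> A \<and>
    (\<forall>f\<in>A. \<forall>g\<in>A. (\<lambda>z. f z + g z) \<in> A) \<and>
    (\<forall>c. \<forall>f\<in>A. (\<lambda>z. c * f z) \<in> A) \<and>
    (\<forall>f\<in>A. \<forall>g\<in>A. (\<lambda>z. f z * g z) \<in> A)"

definition regulariser ::
    "('o \<Rightarrow> complex) set \<Rightarrow> (('o \<Rightarrow> complex) \<Rightarrow> ('x::cbanach \<Rightarrow>\<^sub>C\<^sub>L 'x)) \<Rightarrow>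
      ('o \<Rightarrow> complex) \<Rightarrow> ('o \<Rightarrow> complex) \<Rightarrow> bool"
  where "regulariser E \<Phi> e f \<longleftrightarrow>
    e \<in> E \<and> (\<lambda>z. e z * f z) \<in> E \<and> inj (cblinfun_apply (\<Phi> e))"

locale functional_calculus =
  fixes E F :: "('o \<Rightarrow> complex) set"
    and \<Phi> :: "('o \<Rightarrow> complex) \<Rightarrow> ('x::cbanach \<Rightarrow>\<^sub>C\<^sub>L 'x)"
  assumes F_algebra: "function_algebra F"
    and F_unital: "(\<lambda>_. 1) \<in> F"
    and E_subset: "E \<subseteq> F"
    and E_algebra: "function_algebra E"
    and hom_add: "\<lbrakk>f \<in> E; g \<in> E\<rbrakk> \<Longrightarrow> \<Phi> (\<lambda>z. f z + g z) = \<Phi> f + \<Phi> g"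
    and hom_scale: "f \<in> E \<Longrightarrow> \<Phi> (\<lambda>z. c * f z) = c *\<^sub>C \<Phi> f"
    and hom_mult: "\<lbrakk>f \<in> E; g \<in> E\<rbrakk> \<Longrightarrow> \<Phi> (\<lambda>z. f z * g z) *\<^sub>V x = \<Phi> f *\<^sub>V \<Phi> g *\<^sub>V x"
    and regularisable: "f \<in> F \<Longrightarrow> \<exists>e. regulariser E \<Phi> e f"

text \<open>\<open>\<Phi>(e)\<^sup>-\<^sup>1 \<Phi>(ef)\<close> with its natural domain, for a given \<open>e\<close> and for some regulariser \<open>e\<close>
  of \<open>f\<close>.\<close>

definition calc_via ::
    "(('o \<Rightarrow> complex) \<Rightarrow> ('x::cbanach \<Rightarrow>\<^sub>C\<^sub>L 'x)) \<Rightarrow>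
      ('o \<Rightarrow> complex) \<Rightarrow> ('o \<Rightarrow> complex) \<Rightarrow> 'x \<rightharpoonup> 'x"
  where "calc_via \<Phi> e f x =
    (if \<Phi> (\<lambda>z. e z * f z) *\<^sub>V x \<in> range (cblinfun_apply (\<Phi> e))
     then Some (inv (cblinfun_apply (\<Phi> e)) (\<Phi> (\<lambda>z. e z * f z) *\<^sub>V x)) else None)"

definition calc ::
    "('o \<Rightarrow> complex) set \<Rightarrow> (('o \<Rightarrow> complex) \<Rightarrow> ('x::cbanach \<Rightarrow>\<^sub>C\<^sub>L 'x)) \<Rightarrow>
      ('o \<Rightarrow> complex) \<Rightarrow> 'x \<rightharpoonup> 'x"
  where "calc E \<Phi> f = calc_via \<Phi> (SOME e. regulariser E \<Phi> e f) f"

lemma (in functional_calculus) calc_via_unique: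
  assumes e: "regulariser E \<Phi> e f" and d: "regulariser E \<Phi> d f"
    and y: "\<Phi> (\<lambda>z. e z * f z) *\<^sub>V x = \<Phi> e *\<^sub>V y"
  shows "\<Phi> (\<lambda>z. d z * f z) *\<^sub>V x = \<Phi> d *\<^sub>V y"
proof -
  have E: "e \<in> E" "d \<in> E" "(\<lambda>z. e z * f z) \<in> E" "(\<lambda>z. d z * f z) \<in> E"
    and inj: "inj (cblinfun_apply (\<Phi> e))"
    using e d by (simp_all add: regulariser_def)
  have "\<Phi> e *\<^sub>V \<Phi> (\<lambda>z. d z * f z) *\<^sub>V x = \<Phi> (\<lambda>z. e z * (d z * f z)) *\<^sub>V x"
    using E by (simp add: hom_mult)
  also have "(\<lambda>z. e z * (d z * f z)) = (\<lambda>z. d z * (e z * f z))"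
    by (simp add: fun_eq_iff)
  also have "\<Phi> (\<lambda>z. d z * (e z * f z)) *\<^sub>V x = \<Phi> d *\<^sub>V \<Phi> e *\<^sub>V y"
    using E by (simp add: hom_mult y)
  also have "\<dots> = \<Phi> (\<lambda>z. d z * e z) *\<^sub>V y"
    using E by (simp add: hom_mult)
  also have "(\<lambda>z. d z * e z) = (\<lambda>z. e z * d z)"
    by (simp add: fun_eq_iff)
  also have "\<Phi> (\<lambda>z. e z * d z) *\<^sub>V y = \<Phi> e *\<^sub>V \<Phi> d *\<^sub>V y"
    using E by (simp add: hom_mult)
  finally show ?thesis using inj by (simp add: inj_eq)
qed

lemma calc_via_eq_Some:
  assumes "inj (cblinfun_apply (\<Phi> e))"
  shows "calc_via \<Phi> e f x = Some y \<longleftrightarrow> \<Phi> (\<lambda>z. e z * f z) *\<^sub>V x = \<Phi> e *\<^sub>V y"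
  using assms by (auto simp: calc_via_def f_inv_into_f inj_eq)

lemma (in functional_calculus) calc_eq:
  assumes e: "regulariser E \<Phi> e f"
  shows "calc E \<Phi> f = calc_via \<Phi> e f"
proof
  fix x
  define d where "d = (SOME e. regulariser E \<Phi> e f)"
  have d: "regulariser E \<Phi> d f"
    using someI_ex[of "\<lambda>e. regulariser E \<Phi> e f"] e unfolding d_def by blast
  have "calc_via \<Phi> d f x = Some y \<longleftrightarrow> calc_via \<Phi> e f x = Some y" for y
    using d e calc_via_unique[OF d e, of x y] calc_via_unique[OF e d, of x y]
    by (auto simp: calc_via_eq_Some regulariser_def)
  then show "calc E \<Phi> f x = calc_via \<Phi> e f x"
    unfolding calc_def d_def[symmetric] by (metis not_Some_eq)
qed

definition densely_defined :: "('x::cbanach \<rightharpoonup> 'x) \<Rightarrow> bool"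
  where "densely_defined A \<longleftrightarrow> closure (dom A) = UNIV"

text \<open>The transpose \<open>A'\<close> of a partial operator; \<open>y'\<close> is unique when \<open>A\<close> is densely defined.\<close>

definition transpose_partial :: "('x::cbanach \<rightharpoonup> 'x) \<Rightarrow> 'x cdual \<rightharpoonup> 'x cdual"
  where "transpose_partial A x' =
    (if \<exists>y'. \<forall>x\<in>dom A. x' *\<^sub>V the (A x) = y' *\<^sub>V x
     then Some (THE y'. \<forall>x\<in>dom A. x' *\<^sub>V the (A x) = y' *\<^sub>V x) else None)"

section \<open>Gamma norms\<close>

text \<open>The law of \<open>(\<gamma>\<^sub>1 + i \<gamma>\<^sub>2) / \<surd>2\<close> for independent real standard Gaussians
  \<open>\<gamma>\<^sub>1\<close>, \<open>\<gamma>\<^sub>2\<close>, so that the second absolute moment is \<open>1\<close>.\<close>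

definition complex_std_gaussian :: "complex measure"
  where "complex_std_gaussian =
    distr (std_normal_distribution \<Otimes>\<^sub>M std_normal_distribution) borel
      (\<lambda>(x, y). Complex (x / sqrt 2) (y / sqrt 2))"

lemma sets_complex_std_gaussian [simp, measurable_cong]: "sets complex_std_gaussian = sets borel"
  by (simp add: complex_std_gaussian_def)

lemma measurable_Complex_scaled [measurable]:
  "(\<lambda>(x, y). Complex (x / sqrt 2) (y / sqrt 2)) \<in>
    borel_measurable (std_normal_distribution \<Otimes>\<^sub>M std_normal_distribution)"
  unfolding Complex_eq case_prod_beta by measurable

lemma prob_space_std_normal_pair:
  "prob_space (std_normal_distribution \<Otimes>\<^sub>M std_normal_distribution)"
  by (intro prob_space_pair) (use prob_space_normal_density[of 1 0] in simp_all)

lemma prob_space_complex_std_gaussian: "prob_space complex_std_gaussian"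
  unfolding complex_std_gaussian_def
  by (intro prob_space.prob_space_distr prob_space_std_normal_pair measurable_Complex_scaled)

lemma std_normal_second_moment:
  "has_bochner_integral std_normal_distribution (\<lambda>x. x\<^sup>2) 1"
  using std_normal_moment_even[of 1]
  by (auto simp: has_bochner_integral_iff integrable_density integral_density)

lemma complex_std_gaussian_second_moment:
  "has_bochner_integral complex_std_gaussian (\<lambda>z. (cmod z)\<^sup>2) 1"
proof -
  let ?N = std_normal_distribution
  have N: "prob_space ?N" using prob_space_normal_density[of 1 0] by simp
  interpret N: prob_space ?N by (rule N)
  interpret NN: pair_prob_space ?N ?N ..
  have fst: "has_bochner_integral (?N \<Otimes>\<^sub>M ?N) (\<lambda>p. (fst p)\<^sup>2) 1"
  proof -
    have "has_bochner_integral (distr (?N \<Otimes>\<^sub>M ?N) ?N fst) (\<lambda>x. x\<^sup>2) 1"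
      using std_normal_second_moment by (simp add: N.distr_pair_fst)
    then show ?thesis
      by (simp add: has_bochner_integral_iff integrable_distr_eq integral_distr)
  qed
  have snd: "has_bochner_integral (?N \<Otimes>\<^sub>M ?N) (\<lambda>p. (snd p)\<^sup>2) 1"
    using NN.integrable_product_swap_iff[of "\<lambda>p. (snd p)\<^sup>2"]
      NN.integral_product_swap[of "\<lambda>p. (snd p)\<^sup>2"] fst
    by (simp add: has_bochner_integral_iff case_prod_unfold)
  have "has_bochner_integral (?N \<Otimes>\<^sub>M ?N) (\<lambda>p. ((fst p)\<^sup>2 + (snd p)\<^sup>2) / 2) ((1 + 1) / 2)"
    by (intro has_bochner_integral_divide has_bochner_integral_add fst snd)
  also have "(\<lambda>p. ((fst p)\<^sup>2 + (snd p)\<^sup>2) / 2) =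
      (\<lambda>p. (cmod (case p of (x, y) \<Rightarrow> Complex (x / sqrt 2) (y / sqrt 2)))\<^sup>2)"
    by (auto simp: fun_eq_iff cmod_power2 power_divide add_divide_distrib)
  finally show ?thesis
    unfolding complex_std_gaussian_def
    by (simp add: has_bochner_integral_iff integrable_distr_eq integral_distr)
qed

lemma continuous_scaleC_left: "continuous_on A (\<lambda>c. c *\<^sub>C (x::'x::complex_normed_vector))"
proof -
  have "bounded_linear (\<lambda>c. c *\<^sub>C x)"
    by (rule bounded_linear_intro[where K = "norm x"])
      (simp_all add: scaleC_add_left scaleC_of_real scaleC_scaleC[symmetric] norm_scaleC
        scaleR_conv_of_real)
  then show ?thesis by (rule linear_continuous_on)
qed

lemma measurable_gauss_sum:
  fixes S :: "'h \<Rightarrow> 'x::complex_normed_vector"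
  assumes "finite B"
  shows "(\<lambda>\<omega>. norm (\<Sum>e\<in>B. \<omega> e *\<^sub>C S e)) \<in> borel_measurable (Pi\<^sub>M B (\<lambda>_. complex_std_gaussian))"
proof -
  obtain b and n :: nat where b: "bij_betw b {..<n} B"
    using ex_bij_betw_nat_finite[OF assms] by (auto simp: atLeast0LessThan)
  define g where "g w = norm (\<Sum>i<n. w i *\<^sub>C S (b i))" for w :: "nat \<Rightarrow> complex"
  have [measurable]: "g \<in> borel_measurable borel"
    unfolding g_def
    by (intro borel_measurable_continuous_onI continuous_intros
        continuous_on_compose2[OF continuous_scaleC_left[of UNIV]]) auto
  have mem: "b i \<in> B" if "i < n" for i using b that by (auto simp: bij_betw_def)
  have "(\<lambda>\<omega> i. if i < n then \<omega> (b i) else 0) \<in>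
      Pi\<^sub>M B (\<lambda>_. complex_std_gaussian) \<rightarrow>\<^sub>M Pi\<^sub>M UNIV (\<lambda>_::nat. borel :: complex measure)"
  proof (rule measurable_PiM_single')
    fix i :: nat
    show "(\<lambda>\<omega>. if i < n then \<omega> (b i) else 0) \<in> Pi\<^sub>M B (\<lambda>_. complex_std_gaussian) \<rightarrow>\<^sub>M borel"
      using measurable_component_singleton[OF mem, of i "\<lambda>_. complex_std_gaussian"]
      by (cases "i < n") (simp_all cong: measurable_cong_sets)
  qed simp
  then have [measurable]: "(\<lambda>\<omega> i. if i < n then \<omega> (b i) else 0) \<in>
      Pi\<^sub>M B (\<lambda>_. complex_std_gaussian) \<rightarrow>\<^sub>M (borel :: (nat \<Rightarrow> complex) measure)"
    by (simp add: measurable_cong_sets[OF refl sets_PiM_equal_borel])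
  have "(\<lambda>\<omega>. g (\<lambda>i. if i < n then \<omega> (b i) else 0)) \<in>
      borel_measurable (Pi\<^sub>M B (\<lambda>_. complex_std_gaussian))"
    by measurable
  moreover have "g (\<lambda>i. if i < n then \<omega> (b i) else 0) = norm (\<Sum>e\<in>B. \<omega> e *\<^sub>C S e)" for \<omega>
    unfolding g_def sum.reindex_bij_betw[OF b, symmetric] by simp
  ultimately show ?thesis by simp
qed

lemma integrable_gauss_sum:
  fixes S :: "'h \<Rightarrow> 'x::complex_normed_vector"
  assumes B: "finite B"
  shows "integrable (Pi\<^sub>M B (\<lambda>_. complex_std_gaussian)) (\<lambda>\<omega>. (norm (\<Sum>e\<in>B. \<omega> e *\<^sub>C S e))\<^sup>2)"
proof (rule Bochner_Integration.integrable_bound)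
  let ?P = "Pi\<^sub>M B (\<lambda>_. complex_std_gaussian)"
  let ?b = "\<lambda>\<omega>. (\<Sum>e\<in>B. (cmod (\<omega> e))\<^sup>2) * (\<Sum>e\<in>B. (norm (S e))\<^sup>2)"
  have "integrable ?P (\<lambda>\<omega>. (cmod (\<omega> e))\<^sup>2)" if e: "e \<in> B" for e
  proof -
    have "integrable (distr ?P complex_std_gaussian (\<lambda>\<omega>. \<omega> e)) (\<lambda>z. (cmod z)\<^sup>2)"
      using complex_std_gaussian_second_moment
      by (subst distr_PiM_component[OF prob_space_complex_std_gaussian e])
        (simp add: has_bochner_integral_iff)
    then show ?thesis
      using e by (rule_tac integrable_distr[of "\<lambda>\<omega>. \<omega> e" _ complex_std_gaussian]) auto
  qed
  then show "integrable ?P ?b" by (intro integrable_mult_left Bochner_Integration.integrable_sum)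
  show "(\<lambda>\<omega>. (norm (\<Sum>e\<in>B. \<omega> e *\<^sub>C S e))\<^sup>2) \<in> borel_measurable ?P"
    using measurable_gauss_sum[OF B] by measurable
  have "(norm (\<Sum>e\<in>B. \<omega> e *\<^sub>C S e))\<^sup>2 \<le> ?b \<omega>" for \<omega>
  proof -
    have "norm (\<Sum>e\<in>B. \<omega> e *\<^sub>C S e) \<le> (\<Sum>e\<in>B. cmod (\<omega> e) * norm (S e))"
      by (rule order_trans[OF norm_sum]) (simp add: norm_scaleC)
    then have "(norm (\<Sum>e\<in>B. \<omega> e *\<^sub>C S e))\<^sup>2 \<le> (\<Sum>e\<in>B. cmod (\<omega> e) * norm (S e))\<^sup>2"
      by (simp add: power_mono)
    also have "\<dots> \<le> ?b \<omega>" by (rule Cauchy_Schwarz_ineq_sum)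
    finally show ?thesis .
  qed
  then show "AE \<omega> in ?P. norm ((norm (\<Sum>e\<in>B. \<omega> e *\<^sub>C S e))\<^sup>2) \<le> norm (?b \<omega>)"
    by (intro AE_I2) (simp add: abs_mult sum_nonneg)
qed

definition orthonormal :: "'h::complex_inner set \<Rightarrow> bool"
  where "orthonormal B \<longleftrightarrow> (\<forall>a\<in>B. \<forall>b\<in>B. cinner a b = (if a = b then 1 else 0))"

text \<open>The independent family \<open>(\<gamma>\<^sub>e)\<close>, \<open>e \<in> B\<close>, is realised by the coordinates of a finite
  product space. The integrand is integrable for finite \<open>B\<close> (\<open>integrable_gauss_sum\<close>), so the
  Bochner integral is the genuine expectation.\<close>

definition gauss_sum_norm :: "'h set \<Rightarrow> ('h \<Rightarrow> 'x::complex_normed_vector) \<Rightarrow> real"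
  where "gauss_sum_norm B S =
    sqrt (\<integral>\<omega>. (norm (\<Sum>e\<in>B. \<omega> e *\<^sub>C S e))\<^sup>2 \<partial>Pi\<^sub>M B (\<lambda>_. complex_std_gaussian))"

definition gamma_norm :: "('h::complex_inner \<Rightarrow> 'x::complex_normed_vector) \<Rightarrow> ennreal"
  where "gamma_norm S = (SUP B\<in>{B. finite B \<and> orthonormal B}. ennreal (gauss_sum_norm B S))"

text \<open>The finite rank operator \<open>\<Sum>j<n. g'\<^sub>j \<otimes> x\<^sub>j\<close>.\<close>

definition tensor_sum ::
    "nat \<Rightarrow> (nat \<Rightarrow> 'h cdual) \<Rightarrow> (nat \<Rightarrow> 'x) \<Rightarrow> 'h::complex_normed_vector \<Rightarrow> 'x::complex_vector"
  where "tensor_sum n g' x h = (\<Sum>j<n. (g' j *\<^sub>V h) *\<^sub>C x j)"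

definition finite_rank_ops :: "('h::complex_normed_vector \<Rightarrow> 'x::complex_vector) set"
  where "finite_rank_ops = {tensor_sum n g' x | n g' x. True}"

text \<open>A linear \<open>S\<close> with finite gamma norm is automatically bounded, hence no boundedness
  requirement. Limits are with respect to the gamma norm.\<close>

definition gamma_ops :: "('h::complex_inner \<Rightarrow> 'x::complex_normed_vector) set"
  where "gamma_ops = {S. clinear S \<and> gamma_norm S < \<infinity> \<and>
    (\<forall>\<epsilon>>0. \<exists>U\<in>finite_rank_ops. gamma_norm U < \<infinity> \<and> gamma_norm (\<lambda>h. S h - U h) < \<epsilon>)}"

text \<open>\<open>tr (V'U) = \<Sum>j. \<langle>x\<^sub>j, V g'\<^sub>j\<rangle>\<close> if \<open>U = \<Sum>j. g'\<^sub>j \<otimes> x\<^sub>j\<close>. For linear \<open>V\<close> this does not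
  depend on the representation of \<open>U\<close> (\<open>trace_dual_tensor_sum\<close>).\<close>

definition trace_dual ::
    "('h::complex_normed_vector cdual \<Rightarrow> 'x::complex_normed_vector cdual) \<Rightarrow> ('h \<Rightarrow> 'x) \<Rightarrow> complex"
  where "trace_dual V U =
    (THE t. \<exists>n g' x. U = tensor_sum n g' x \<and> t = (\<Sum>j<n. V (g' j) *\<^sub>V x j))"

lemma cblinfun_zero_left [simp]: "0 *\<^sub>V x = 0"
  by (simp add: zero_cblinfun.rep_eq)

lemma cblinfun_add_right: "f *\<^sub>V (x + y) = f *\<^sub>V x + f *\<^sub>V y"
  using bounded_clinear_cblinfun_apply[of f] by (simp add: bounded_clinear_def clinear_def)

lemma cblinfun_scaleC_right: "f *\<^sub>V (c *\<^sub>C x) = c *\<^sub>C (f *\<^sub>V x)"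
  using bounded_clinear_cblinfun_apply[of f] by (simp add: bounded_clinear_def clinear_def)

lemma cblinfun_zero_right [simp]: "f *\<^sub>V 0 = 0"
  using cblinfun_add_right[of f 0 0] by simp

lemma cblinfun_sum_right: "f *\<^sub>V (\<Sum>j\<in>A. x j) = (\<Sum>j\<in>A. f *\<^sub>V x j)"
  by (induction A rule: infinite_finite_induct) (simp_all add: cblinfun_add_right)

lemma scaleC_zero_left [simp]: "0 *\<^sub>C (x::'a::complex_vector) = 0"
  using scaleC_add_left[of 0 0 x] by simp

lemma scaleC_one [simp]: "1 *\<^sub>C (x::'a::complex_vector) = x"
  using scaleC_of_real[of 1 x] by simp

lemma scaleC_sum_right: "c *\<^sub>C (\<Sum>j\<in>A. x j :: 'a::complex_vector) = (\<Sum>j\<in>A. c *\<^sub>C x j)"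
  by (induction A rule: infinite_finite_induct) (simp_all add: scaleC_add_right)

lemma trace_zero:
  fixes V :: "'h::complex_normed_vector cdual \<Rightarrow> 'x::complex_normed_vector cdual"
  assumes V: "clinear V"
  shows "finite A \<Longrightarrow> (\<And>h. (\<Sum>j\<in>A. (g' j *\<^sub>V h) *\<^sub>C x j) = 0) \<Longrightarrow> (\<Sum>j\<in>A. V (g' j) *\<^sub>V x j) = 0"
proof (induction A arbitrary: g' rule: finite_induct)
  case (insert a A)
  have V_add: "V (p + q) = V p + V q" and V_scale: "V (c *\<^sub>C p) = c *\<^sub>C V p" for p q c
    using V by (simp_all add: clinear_def)
  have V_zero: "V 0 = 0" using V_add[of 0 0] by simp
  have eq: "(g' a *\<^sub>V h) *\<^sub>C x a + (\<Sum>j\<in>A. (g' j *\<^sub>V h) *\<^sub>C x j) = 0" for h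
    using insert by simp
  show ?case
  proof (cases "g' a = 0")
    case True
    then show ?thesis using insert.IH[of g'] insert.hyps eq by (simp add: V_zero)
  next
    case False
    then obtain h0 where h0: "g' a *\<^sub>V h0 \<noteq> 0"
      using cblinfun_eqI[of "g' a" 0] by auto
    define c where "c j = - ((g' j *\<^sub>V h0) / (g' a *\<^sub>V h0))" for j
    have minus_one: "(-1) *\<^sub>C v = - v" for v :: 'x
      using scaleC_of_real[of "-1" v] by simp
    have "x a = - ((1 / (g' a *\<^sub>V h0)) *\<^sub>C (\<Sum>j\<in>A. (g' j *\<^sub>V h0) *\<^sub>C x j))"
    proof -
      have "(1 / (g' a *\<^sub>V h0)) *\<^sub>C (g' a *\<^sub>V h0) *\<^sub>C x a = x a"
        using h0 by (simp add: scaleC_scaleC)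
      moreover have "(g' a *\<^sub>V h0) *\<^sub>C x a = - (\<Sum>j\<in>A. (g' j *\<^sub>V h0) *\<^sub>C x j)"
        using eq[of h0] by (simp add: eq_neg_iff_add_eq_0)
      ultimately show ?thesis by (metis scaleC_minus_right)
    qed
    also have "\<dots> = (-1) *\<^sub>C (1 / (g' a *\<^sub>V h0)) *\<^sub>C (\<Sum>j\<in>A. (g' j *\<^sub>V h0) *\<^sub>C x j)"
      by (rule minus_one[symmetric])
    also have "\<dots> = (\<Sum>j\<in>A. c j *\<^sub>C x j)"
      unfolding scaleC_scaleC scaleC_sum_right c_def by (intro sum.cong refl) simp
    finally have xa: "x a = (\<Sum>j\<in>A. c j *\<^sub>C x j)" .
    have "(\<Sum>j\<in>A. ((g' j + c j *\<^sub>C g' a) *\<^sub>V h) *\<^sub>C x j) = 0" for h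
      using eq[of h] unfolding xa
      by (simp add: plus_cblinfun.rep_eq scaleC_cblinfun.rep_eq scaleC_complex_def scaleC_add_left
          scaleC_sum_right scaleC_scaleC sum.distrib mult.commute add.commute)
    then have "(\<Sum>j\<in>A. V (g' j + c j *\<^sub>C g' a) *\<^sub>V x j) = 0"
      by (rule insert.IH)
    then show ?thesis
      using insert.hyps unfolding xa
      by (simp add: V_add V_scale plus_cblinfun.rep_eq scaleC_cblinfun.rep_eq cblinfun_sum_right
          cblinfun_scaleC_right sum.distrib add.commute xa)
  qed
qed simp

lemma trace_dual_tensor_sum:
  fixes V :: "'h::complex_normed_vector cdual \<Rightarrow> 'x::complex_normed_vector cdual"
  assumes V: "clinear V"
  shows "trace_dual V (tensor_sum n g' x) = (\<Sum>j<n. V (g' j) *\<^sub>V x j)"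
  unfolding trace_dual_def
proof (rule the_equality)
  fix t
  assume "\<exists>m k' y. tensor_sum n g' x = tensor_sum m k' y \<and> t = (\<Sum>j<m. V (k' j) *\<^sub>V y j)"
  then obtain m k' y where eq: "tensor_sum n g' x = tensor_sum m k' y"
    and t: "t = (\<Sum>j<m. V (k' j) *\<^sub>V y j)" by blast
  have V_minus: "V (- p) = - V p" for p
  proof -
    have "V 0 = V 0 + V 0" "V (p + - p) = V p + V (- p)"
      using V unfolding clinear_def by (metis add.right_neutral, blast)
    then show ?thesis by (simp add: eq_neg_iff_add_eq_0 add.commute)
  qed
  have minus: "(- p) *\<^sub>C v = - (p *\<^sub>C v)" for p and v :: 'x
    using scaleC_add_left[of p "- p" v] by (simp add: eq_neg_iff_add_eq_0 add.commute)
  let ?g = "case_sum g' (\<lambda>j. - k' j)" and ?x = "case_sum x y"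
  have "(\<Sum>j\<in>{..<n} <+> {..<m}. V (?g j) *\<^sub>V ?x j) = 0"
  proof (rule trace_zero[OF V])
    fix h
    show "(\<Sum>j\<in>{..<n} <+> {..<m}. (?g j *\<^sub>V h) *\<^sub>C ?x j) = 0"
      using fun_cong[OF eq, of h]
      by (simp add: sum.Plus tensor_sum_def uminus_cblinfun.rep_eq minus sum_negf)
  qed simp
  then show "t = (\<Sum>j<n. V (g' j) *\<^sub>V x j)"
    by (simp add: sum.Plus t V_minus uminus_cblinfun.rep_eq sum_negf)
qed blast

definition gamma_dual_norm ::
    "('h::complex_inner cdual \<Rightarrow> 'x::complex_normed_vector cdual) \<Rightarrow> ennreal"
  where "gamma_dual_norm V =
    (SUP U\<in>{U \<in> finite_rank_ops. gamma_norm U \<le> 1}. ennreal (cmod (trace_dual V U)))"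

definition gamma_dual_ops :: "('h::complex_inner cdual \<Rightarrow> 'x::complex_normed_vector cdual) set"
  where "gamma_dual_ops = {V. bounded_clinear V \<and> gamma_dual_norm V < \<infinity>}"

section \<open>Square functions and dual square functions\<close>

definition diamond_left ::
    "'h::complex_normed_vector \<Rightarrow> ('o \<Rightarrow> 'h cdual) \<Rightarrow> 'o \<Rightarrow> complex" (infix \<open>\<diamondop>\<^sub>L\<close> 72)
  where "(h \<diamondop>\<^sub>L f) z = f z *\<^sub>V h"

definition diamond_right ::
    "('o \<Rightarrow> 'h::complex_normed_vector) \<Rightarrow> 'h cdual \<Rightarrow> 'o \<Rightarrow> complex" (infix \<open>\<diamondop>\<^sub>R\<close> 72)
  where "(f \<diamondop>\<^sub>R h') z = h' *\<^sub>V f z"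

lemma diamond_left_transpose: "k \<diamondop>\<^sub>L (cblinfun_apply (transpose_op T) \<circ> g) = (T *\<^sub>V k) \<diamondop>\<^sub>L g"
  by (simp add: fun_eq_iff diamond_left_def cblinfun_compose.rep_eq)

lemma diamond_right_comp: "(cblinfun_apply T \<circ> f) \<diamondop>\<^sub>R h' = f \<diamondop>\<^sub>R (transpose_op T *\<^sub>V h')"
  by (simp add: fun_eq_iff diamond_right_def cblinfun_compose.rep_eq)

definition dual_valued :: "('o \<Rightarrow> complex) set \<Rightarrow> ('o \<Rightarrow> 'h::chilbert_space cdual) set"
  where "dual_valued F = {f. \<forall>h. h \<diamondop>\<^sub>L f \<in> F}"

definition space_valued :: "('o \<Rightarrow> complex) set \<Rightarrow> ('o \<Rightarrow> 'h::chilbert_space) set"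
  where "space_valued F = {f. \<forall>h'. f \<diamondop>\<^sub>R h' \<in> F}"

definition square_fun ::
    "('o \<Rightarrow> complex) set \<Rightarrow> (('o \<Rightarrow> complex) \<Rightarrow> ('x::cbanach \<Rightarrow>\<^sub>C\<^sub>L 'x)) \<Rightarrow>
      ('o \<Rightarrow> 'h::chilbert_space cdual) \<Rightarrow> 'x \<rightharpoonup> ('h \<Rightarrow> 'x)"
  where "square_fun E \<Phi> f x =
    (if (\<forall>h. x \<in> dom (calc E \<Phi> (h \<diamondop>\<^sub>L f))) \<and>
        (\<lambda>h. the (calc E \<Phi> (h \<diamondop>\<^sub>L f) x)) \<in> gamma_ops
     then Some (\<lambda>h. the (calc E \<Phi> (h \<diamondop>\<^sub>L f) x)) else None)"

text \<open>Only meaningful if all \<open>calc E \<Phi> (f \<diamondop>\<^sub>R h')\<close> are densely defined. This property passes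
  from \<open>f\<close> to \<open>T \<circ> f\<close> by \<open>diamond_right_comp\<close>.\<close>

definition dual_square_fun ::
    "('o \<Rightarrow> complex) set \<Rightarrow> (('o \<Rightarrow> complex) \<Rightarrow> ('x::cbanach \<Rightarrow>\<^sub>C\<^sub>L 'x)) \<Rightarrow>
      ('o \<Rightarrow> 'h::chilbert_space) \<Rightarrow> 'x cdual \<rightharpoonup> ('h cdual \<Rightarrow> 'x cdual)"
  where "dual_square_fun E \<Phi> f x' =
    (if (\<forall>h'. x' \<in> dom (transpose_partial (calc E \<Phi> (f \<diamondop>\<^sub>R h')))) \<and>
        (\<lambda>h'. the (transpose_partial (calc E \<Phi> (f \<diamondop>\<^sub>R h')) x')) \<in> gamma_dual_ops
     then Some (\<lambda>h'. the (transpose_partial (calc E \<Phi> (f \<diamondop>\<^sub>R h')) x')) else None)"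

text \<open>The conditions on \<^const>\<open>ran\<close> express that the operators take values in \<open>\<gamma>(K;X)\<close> and
  \<open>\<gamma>(H;X)\<close>, respectively in \<open>\<gamma>'(H';X')\<close> and \<open>\<gamma>'(K';X')\<close>.\<close>

definition subordinate ::
    "('x::cbanach \<rightharpoonup> ('k::chilbert_space \<Rightarrow> 'x)) \<Rightarrow> ('x \<rightharpoonup> ('h::chilbert_space \<Rightarrow> 'x)) \<Rightarrow> bool"
  where "subordinate Q R \<longleftrightarrow>
    ran Q \<subseteq> gamma_ops \<and> ran R \<subseteq> gamma_ops \<and> dom R \<subseteq> dom Q \<and>
    (\<exists>T :: 'k \<Rightarrow>\<^sub>C\<^sub>L 'h. \<forall>x\<in>dom R. the (Q x) = the (R x) \<circ> cblinfun_apply T)"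

definition dual_subordinate ::
    "('x::cbanach cdual \<rightharpoonup> ('h::chilbert_space cdual \<Rightarrow> 'x cdual)) \<Rightarrow>
      ('x cdual \<rightharpoonup> ('k::chilbert_space cdual \<Rightarrow> 'x cdual)) \<Rightarrow> bool"
  where "dual_subordinate Q R \<longleftrightarrow>
    ran Q \<subseteq> gamma_dual_ops \<and> ran R \<subseteq> gamma_dual_ops \<and> dom R \<subseteq> dom Q \<and>
    (\<exists>S :: 'h cdual \<Rightarrow>\<^sub>C\<^sub>L 'k cdual. \<forall>x'\<in>dom R. the (Q x') = the (R x') \<circ> cblinfun_apply S)"

end

theory Submission
  imports Defs
begin

text \<open>
  On the level of the functional calculus there is nothing to do: \<open>k \<diamondop> (T' \<circ> g) = (T k) \<diamondop> g\<close>
  and \<open>(T \<circ> f) \<diamondop> h' = f \<diamondop> (T' h')\<close>, so the operators that define the new square functions are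
  the old ones composed with \<open>T\<close>, respectively with \<open>T'\<close>. What has to be shown is that such a
  composition does not leave \<open>\<gamma>(H;X)\<close> and \<open>\<gamma>'(K';X')\<close>, that is, the ideal property of these
  spaces (\<open>gamma_ops_compose\<close>, \<open>gamma_dual_ops_compose\<close>). Since \<open>U \<circ> T\<close> is a finite
  rank operator near \<open>S \<circ> T\<close> if \<open>U\<close> is one near \<open>S\<close>, and since
  \<open>tr ((V \<circ> T')' U) = tr (V' (U \<circ> T))\<close>, both follow from the inequality
  \<open>\<parallel>S \<circ> T\<parallel>\<^sub>\<gamma> \<le> \<parallel>T\<parallel> \<parallel>S\<parallel>\<^sub>\<gamma>\<close> for linear \<open>S\<close>, and by scaling it suffices to treat contractions \<open>T\<close>
  (\<open>gamma_norm_contraction\<close>).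

  So let \<open>v\<^sub>1, \<dots>, v\<^sub>n\<close> be the images under \<open>T\<close> of a finite orthonormal system. They satisfy
  \<open>\<parallel>\<Sum> c\<^sub>i v\<^sub>i\<parallel>\<^sup>2 \<le> \<Sum> |c\<^sub>i|\<^sup>2\<close>, and they lie in the span of some finite orthonormal system
  \<open>f\<^sub>1, \<dots>, f\<^sub>m\<close>. The claim is
  \<open>\<bbbE> \<parallel>\<Sum> \<gamma>\<^sub>i S v\<^sub>i\<parallel>\<^sup>2 \<le> \<bbbE> \<parallel>\<Sum> \<gamma>\<^sub>j S f\<^sub>j\<parallel>\<^sup>2\<close> (\<open>gauss_moment_contractive\<close>). The proof is a Schur
  complement argument that rests on two facts about Gaussian sums: their second moments are
  invariant under unitary mixing of two of the vectors (\<open>gauss_moment_rotate\<close>), and dropping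
  a summand does not increase the second moment (\<open>gauss_moment_le_Cons\<close>).

  The induction is on \<open>m\<close>. Mixing two vectors at a time, one reaches a list in which only the
  first vector is not orthogonal to \<open>f = f\<^sub>1\<close> (\<open>givens_eliminate\<close>); this changes neither the
  Gaussian moment nor the contraction condition. The first vector is now
  \<open>v = \<alpha> f + \<beta> w\<close> with \<open>|\<alpha>|\<^sup>2 + \<beta>\<^sup>2 = 1\<close> and \<open>w \<bottom> f\<close>, and the contraction condition for
  \<open>v, v\<^sub>2, \<dots>, v\<^sub>n\<close> implies the same condition for \<open>w, v\<^sub>2, \<dots>, v\<^sub>n\<close>
  (\<open>contractive_split\<close>). As \<open>v\<close> is one of the two vectors of a unitary mixture of \<open>f\<close> and \<open>w\<close>,
  the moment of \<open>v, v\<^sub>2, \<dots>, v\<^sub>n\<close> is at most the moment of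
  \<open>f, w, v\<^sub>2, \<dots>, v\<^sub>n\<close>. The vectors after \<open>f\<close> lie in the span of \<open>f\<^sub>2, \<dots>, f\<^sub>m\<close>, and the induction hypothesis applies to them.
\<close>

section \<open>Complex vector and inner product spaces\<close>

lemma scaleC_minus_left: "(- c) *\<^sub>C (x::'a::complex_vector) = - (c *\<^sub>C x)"
  using scaleC_add_left[of c "- c" x] by (simp add: eq_neg_iff_add_eq_0 add.commute)

lemma scaleC_diff_left: "(c - d) *\<^sub>C (x::'a::complex_vector) = c *\<^sub>C x - d *\<^sub>C x"
  using scaleC_add_left[of c "- d" x] by (simp add: scaleC_minus_left)

lemma clinear_diff: "clinear f \<Longrightarrow> f (x - y) = f x - f y"
  using scaleC_minus_left[of 1] unfolding clinear_def
  by (metis add_uminus_conv_diff scaleC_one)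

lemma clinear_cblinfun_apply: "clinear (cblinfun_apply T)"
  using bounded_clinear_cblinfun_apply by (auto simp: bounded_clinear_def)

lemma cinner_zero_left [simp]: "cinner 0 (x::'a::complex_inner) = 0"
  using cinner_add_left[of 0 0 x] by simp

lemma cinner_minus_left: "cinner (- x) (y::'a::complex_inner) = - cinner x y"
  using cinner_add_left[of x "- x" y] by (simp add: eq_neg_iff_add_eq_0 add.commute)

lemma cinner_diff_left: "cinner (x - y) (z::'a::complex_inner) = cinner x z - cinner y z"
  using cinner_add_left[of x "- y" z] by (simp add: cinner_minus_left)

lemma cinner_sum_left: "cinner (\<Sum>i\<in>A. f i) (z::'a::complex_inner) = (\<Sum>i\<in>A. cinner (f i) z)"
  by (induction A rule: infinite_finite_induct) (simp_all add: cinner_add_left)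

lemma cinner_add_right: "cinner (x::'a::complex_inner) (y + z) = cinner x y + cinner x z"
  by (metis cinner_add_left cinner_commute complex_cnj_add)

lemma cinner_scaleC_right: "cinner (x::'a::complex_inner) (c *\<^sub>C y) = cnj c * cinner x y"
  by (metis cinner_scaleC_left cinner_commute complex_cnj_mult)

lemma norm_pythagoras:
  assumes "cinner x (y::'a::complex_inner) = 0"
  shows "(norm (x + y))\<^sup>2 = (norm x)\<^sup>2 + (norm y)\<^sup>2"
proof -
  have "cinner y x = 0" using assms cinner_commute[of y x] by simp
  then have "complex_of_real ((norm (x + y))\<^sup>2) = complex_of_real ((norm x)\<^sup>2 + (norm y)\<^sup>2)"
    using assms unfolding of_real_add cinner_norm[symmetric]
    by (simp add: cinner_add_left cinner_add_right)
  then show ?thesis by (simp only: of_real_eq_iff)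
qed

definition csubspace :: "'a::complex_vector set \<Rightarrow> bool"
  where "csubspace V \<longleftrightarrow> 0 \<in> V \<and> (\<forall>x\<in>V. \<forall>y\<in>V. x + y \<in> V) \<and> (\<forall>c. \<forall>x\<in>V. c *\<^sub>C x \<in> V)"

lemma csubspace_diff: "csubspace V \<Longrightarrow> x \<in> V \<Longrightarrow> y \<in> V \<Longrightarrow> x - y \<in> V"
  using scaleC_minus_left[of 1 y] unfolding csubspace_def
  by (metis add_uminus_conv_diff scaleC_one)

text \<open>For a finite orthonormal system \<open>B\<close> this is its linear span. Membership is phrased through the
  Fourier expansion, so that the part along \<open>f\<close> drops out at once for vectors orthogonal to \<open>f\<close>
  (\<open>ortho_span_insert\<close>).\<close>

definition ortho_span :: "'h::complex_inner set \<Rightarrow> 'h set"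
  where "ortho_span B = {v. (\<Sum>f\<in>B. cinner v f *\<^sub>C f) = v}"

lemma csubspace_ortho_span: "csubspace (ortho_span B)"
  by (simp add: csubspace_def ortho_span_def cinner_add_left cinner_scaleC_left scaleC_add_left
      sum.distrib scaleC_scaleC[symmetric] flip: scaleC_sum_right)

lemma ortho_span_insert:
  assumes "finite B" "f \<notin> B" "cinner v f = 0"
  shows "v \<in> ortho_span (insert f B) \<longleftrightarrow> v \<in> ortho_span B"
  using assms by (simp add: ortho_span_def)

lemma ortho_span_orthogonal:
  assumes "v \<in> ortho_span B" "\<And>f. f \<in> B \<Longrightarrow> cinner f g = 0"
  shows "cinner v g = 0"
proof -
  have "cinner v g = cinner (\<Sum>f\<in>B. cinner v f *\<^sub>C f) g"
    using assms(1) by (simp add: ortho_span_def)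
  also have "\<dots> = 0" by (simp add: cinner_sum_left cinner_scaleC_left assms(2))
  finally show ?thesis .
qed

lemma orthonormal_norm: "orthonormal B \<Longrightarrow> f \<in> B \<Longrightarrow> norm f = 1"
proof -
  assume "orthonormal B" "f \<in> B"
  then have "cinner f f = 1" by (simp add: orthonormal_def)
  then have "(norm f)\<^sup>2 = 1" unfolding cinner_norm by (simp only: of_real_eq_1_iff)
  then show "norm f = 1" by (simp add: power2_eq_1_iff) (smt (verit) norm_ge_zero)
qed

text \<open>Gram-Schmidt orthonormalisation: the residual \<open>u\<close> of \<open>v\<close> against the system found so far is
  normalised and added, unless it vanishes.\<close>

lemma orthonormal_list_spanning:
  fixes vs :: "'h::complex_inner list"
  shows "\<exists>fs. distinct fs \<and> orthonormal (set fs) \<and> set vs \<subseteq> ortho_span (set fs)"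
proof (induction vs)
  case Nil
  then show ?case by (intro exI[of _ "[]"]) (simp add: orthonormal_def)
next
  case (Cons v vs)
  then obtain fs where fs: "distinct fs" "orthonormal (set fs)" "set vs \<subseteq> ortho_span (set fs)" by blast
  define u where "u = v - (\<Sum>f\<in>set fs. cinner v f *\<^sub>C f)"
  have ug: "cinner u g = 0" if "g \<in> set fs" for g
  proof -
    have "(\<Sum>f\<in>set fs. cinner (cinner v f *\<^sub>C f) g) = (\<Sum>f\<in>set fs. if f = g then cinner v g else 0)"
      using fs(2) that by (intro sum.cong) (auto simp: orthonormal_def cinner_scaleC_left)
    also have "\<dots> = cinner v g" using that by simp
    finally show ?thesis by (simp add: u_def cinner_diff_left cinner_sum_left)
  qed
  show ?case
  proof (cases "u = 0")
    case True
    then have "v \<in> ortho_span (set fs)" by (simp add: u_def ortho_span_def)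
    then show ?thesis using fs by auto
  next
    case False
    let ?c = "complex_of_real (1 / norm u)"
    define e where "e = ?c *\<^sub>C u"
    have eg: "cinner e g = 0" "cinner g e = 0" if "g \<in> set fs" for g
      using ug[OF that] cinner_commute[of g u] by (simp_all add: e_def cinner_scaleC_left cinner_scaleC_right)
    have "complex_of_real (norm e) = 1"
      using False by (simp add: e_def norm_scaleC norm_divide)
    then have ee: "cinner e e = 1" by (simp add: cinner_norm)
    then have enot: "e \<notin> set fs" using eg(1) by fastforce
    have on: "orthonormal (set (e # fs))"
      using fs(2) eg ee enot by (auto simp: orthonormal_def)
    have sub: "ortho_span (set fs) \<subseteq> ortho_span (set (e # fs))"
    proof
      fix x assume x: "x \<in> ortho_span (set fs)"
      then have "cinner x e = 0" by (rule ortho_span_orthogonal) (simp add: eg)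
      then show "x \<in> ortho_span (set (e # fs))" using x enot by (simp add: ortho_span_insert)
    qed
    have proj: "(\<Sum>f\<in>set fs. cinner v f *\<^sub>C f) \<in> ortho_span (set (e # fs))"
    proof -
      have "(\<Sum>f\<in>set fs. cinner v f *\<^sub>C f) = v - u" by (simp add: u_def)
      moreover have "cinner (v - u) f = cinner v f" if "f \<in> set fs" for f
        using ug[OF that] by (simp add: cinner_diff_left)
      ultimately have "v - u \<in> ortho_span (set fs)" by (simp add: ortho_span_def)
      then show ?thesis using sub \<open>_ = v - u\<close> by auto
    qed
    have e_mem: "e \<in> ortho_span (set (e # fs))"
      using enot eg ee by (simp add: ortho_span_def)
    have "complex_of_real (norm u) *\<^sub>C e = u"
      using False by (simp add: e_def scaleC_scaleC)
    then have "v = (\<Sum>f\<in>set fs. cinner v f *\<^sub>C f) + complex_of_real (norm u) *\<^sub>C e"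
      by (simp add: u_def)
    then have "v \<in> ortho_span (set (e # fs))"
      using proj e_mem csubspace_ortho_span[of "set (e # fs)"] unfolding csubspace_def by metis
    then show ?thesis using fs on sub enot by (intro exI[of _ "e # fs"]) auto
  qed
qed

section \<open>Unitary invariance of a pair of complex Gaussians\<close>

text \<open>The standard Gaussian on \<open>\<complex>\<close> is the image under \<open>plane_point\<close> of a Gaussian on \<open>\<real> \<times> \<real>\<close>; the
  factor \<open>1 / \<surd>2\<close> normalises its second moment. Unitary invariance of a pair of such variables
  comes from Lebesgue measure: its density depends on \<open>|z|\<^sup>2 + |w|\<^sup>2\<close> only, and a unitary matrix of
  determinant one is a product of complex shears \<open>(z, w) \<mapsto> (z + p w, w)\<close> and
  \<open>(z, w) \<mapsto> (z, w + s z)\<close>. Shears preserve Lebesgue measure by Fubini's theorem and translation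
  invariance.\<close>

definition plane_point :: "real \<times> real \<Rightarrow> complex"
  where "plane_point p = Complex (fst p / sqrt 2) (snd p / sqrt 2)"

lemma measurable_plane_point [measurable]: "plane_point \<in> borel_measurable borel"
  unfolding plane_point_def[abs_def]
  by (intro borel_measurable_continuous_onI continuous_intros) auto

lemma nn_integral_plane_translate:
  assumes [measurable]: "g \<in> borel_measurable borel"
  shows "(\<integral>\<^sup>+p. g (plane_point p + a) \<partial>lborel) = (\<integral>\<^sup>+p. g (plane_point p) \<partial>lborel)"
proof -
  define b where "b = (sqrt 2 * Re a, sqrt 2 * Im a)"
  have b: "plane_point (b + p) = plane_point p + a" for p
    by (simp add: plane_point_def b_def complex_eq_iff add_divide_distrib)
  have "(\<integral>\<^sup>+p. g (plane_point p) \<partial>lborel) = (\<integral>\<^sup>+p. g (plane_point p) \<partial>distr lborel borel ((+) b))"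
    by (simp add: lborel_distr_plus)
  also have "\<dots> = (\<integral>\<^sup>+p. g (plane_point p + a) \<partial>lborel)"
    by (subst nn_integral_distr) (simp_all add: b)
  finally show ?thesis ..
qed

definition plane_pair_integral :: "(complex \<Rightarrow> complex \<Rightarrow> ennreal) \<Rightarrow> ennreal"
  where "plane_pair_integral f =
    (\<integral>\<^sup>+p. \<integral>\<^sup>+q. f (plane_point p) (plane_point q) \<partial>lborel \<partial>lborel)"

lemma plane_pair_integral_swap:
  assumes [measurable]: "case_prod f \<in> borel_measurable (borel \<Otimes>\<^sub>M borel)"
  shows "plane_pair_integral f = plane_pair_integral (\<lambda>z w. f w z)"
  unfolding plane_pair_integral_def by (rule lborel_pair.Fubini') measurable

lemma plane_pair_integral_shear_right:
  assumes [measurable]: "case_prod f \<in> borel_measurable (borel \<Otimes>\<^sub>M borel)"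
  shows "plane_pair_integral (\<lambda>z w. f z (w + s * z)) = plane_pair_integral f"
  unfolding plane_pair_integral_def
  by (intro nn_integral_cong nn_integral_plane_translate) measurable

lemma plane_pair_integral_shear_left:
  assumes [measurable]: "case_prod f \<in> borel_measurable (borel \<Otimes>\<^sub>M borel)"
  shows "plane_pair_integral (\<lambda>z w. f (z + s * w) w) = plane_pair_integral f"
proof -
  have "plane_pair_integral (\<lambda>z w. f (z + s * w) w) = plane_pair_integral (\<lambda>w z. f (z + s * w) w)"
    by (rule plane_pair_integral_swap) measurable
  also have "\<dots> = plane_pair_integral (\<lambda>w z. f z w)"
    by (rule plane_pair_integral_shear_right[of "\<lambda>w z. f z w"]) measurable
  also have "\<dots> = plane_pair_integral f"
    by (rule plane_pair_integral_swap) measurable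
  finally show ?thesis .
qed

lemma plane_pair_integral_unitary_shears:
  assumes [measurable]: "case_prod f \<in> borel_measurable (borel \<Otimes>\<^sub>M borel)"
    and cs: "c * cnj c + s * cnj s = 1" and s: "s \<noteq> 0"
  shows "plane_pair_integral (\<lambda>z w. f (c * z - cnj s * w) (s * z + cnj c * w)) =
    plane_pair_integral f"
proof -
  \<comment> \<open>Write \<open>U\<^sub>p\<close> for the map \<open>(z, w) \<mapsto> (z + p w, w)\<close> and \<open>L\<^sub>s\<close> for \<open>(z, w) \<mapsto> (z, w + s z)\<close>.
    The matrix of \<open>U\<^sub>p L\<^sub>s U\<^sub>q\<close> has diagonal \<open>1 + p s\<close>, \<open>1 + s q\<close> and lower left entry \<open>s\<close>, which
    forces the choice of \<open>p\<close> and \<open>q\<close>; the remaining entry is then fixed by the determinant.\<close>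
  define p q where "p = (c - 1) / s" and "q = (cnj c - 1) / s"
  have ps: "p * s = c - 1" and qs: "s * q = cnj c - 1" using s by (simp_all add: p_def q_def)
  have "s * (q + p * cnj c) = s * q + (p * s) * cnj c"
    by (simp add: algebra_simps)
  also have "\<dots> = c * cnj c - 1" unfolding ps qs by (simp add: algebra_simps)
  also have "\<dots> = s * - cnj s" unfolding cs[symmetric] by simp
  finally have pq: "q + p * cnj c = - cnj s" using s by (metis mult_left_cancel)
  have left: "(z + q * w) + p * (s * z + cnj c * w) = c * z - cnj s * w"
    and right: "w + s * (z + q * w) = s * z + cnj c * w" for z w
  proof -
    have "(z + q * w) + p * (s * z + cnj c * w) = (1 + p * s) * z + (q + p * cnj c) * w"
      by (simp add: algebra_simps)
    then show "(z + q * w) + p * (s * z + cnj c * w) = c * z - cnj s * w"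
      unfolding ps pq by simp
    have "w + s * (z + q * w) = s * z + (1 + s * q) * w"
      by (simp add: algebra_simps)
    then show "w + s * (z + q * w) = s * z + cnj c * w"
      unfolding qs by simp
  qed
  have "plane_pair_integral (\<lambda>z w. f (c * z - cnj s * w) (s * z + cnj c * w)) =
      plane_pair_integral (\<lambda>z w. f ((z + q * w) + p * (w + s * (z + q * w))) (w + s * (z + q * w)))"
    by (simp only: right left)
  also have "\<dots> = plane_pair_integral (\<lambda>z w. f (z + p * (w + s * z)) (w + s * z))"
    by (rule plane_pair_integral_shear_left[of "\<lambda>z w. f (z + p * (w + s * z)) (w + s * z)"]) measurable
  also have "\<dots> = plane_pair_integral (\<lambda>z w. f (z + p * w) w)"
    by (rule plane_pair_integral_shear_right[of "\<lambda>z w. f (z + p * w) w"]) measurable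
  also have "\<dots> = plane_pair_integral f"
    by (rule plane_pair_integral_shear_left) measurable
  finally show ?thesis .
qed

lemma plane_pair_integral_unitary:
  assumes f[measurable]: "case_prod f \<in> borel_measurable (borel \<Otimes>\<^sub>M borel)"
    and cs: "c * cnj c + s * cnj s = 1"
  shows "plane_pair_integral (\<lambda>z w. f (c * z - cnj s * w) (s * z + cnj c * w)) =
    plane_pair_integral f"
proof (cases "s = 0")
  case True
  \<comment> \<open>A diagonal matrix is a product of two antidiagonal ones, to which the factorisation into
    shears applies.\<close>
  then have c: "c * cnj c = 1" using cs by simp
  have "plane_pair_integral (\<lambda>z w. f (c * z - cnj s * w) (s * z + cnj c * w)) =
      plane_pair_integral (\<lambda>z w. f (- (- c * z + cnj 0 * w)) (0 * z - cnj (- c) * w))"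
    by (simp add: True)
  also have "\<dots> = plane_pair_integral (\<lambda>z w. f (- w) z)"
    by (rule plane_pair_integral_unitary_shears) (use c in auto)
  also have "\<dots> = plane_pair_integral f"
    using plane_pair_integral_unitary_shears[of f 0 1] by simp
  finally show ?thesis .
next
  case False
  then show ?thesis by (rule plane_pair_integral_unitary_shears[OF f cs])
qed

lemma complex_std_gaussian_nn_integral:
  assumes [measurable]: "f \<in> borel_measurable borel"
  shows "(\<integral>\<^sup>+z. f z \<partial>complex_std_gaussian) =
    (\<integral>\<^sup>+p. ennreal (exp (- (cmod (plane_point p))\<^sup>2) / (2 * pi)) * f (plane_point p) \<partial>lborel)"
proof -
  let ?n = "\<lambda>x. ennreal (std_normal_density x)"
  have dens: "?n x * (?n y * a) = ennreal (exp (- (cmod (plane_point (x, y)))\<^sup>2) / (2 * pi)) * a"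
    for x y a
  proof -
    have "std_normal_density x * std_normal_density y =
        exp (- (cmod (plane_point (x, y)))\<^sup>2) / (2 * pi)"
      by (simp add: std_normal_density_def plane_point_def cmod_power2 power_divide
          add_divide_distrib flip: exp_add)
    then show ?thesis by (simp flip: ennreal_mult' mult.assoc)
  qed
  interpret N: prob_space std_normal_distribution by (simp add: prob_space_normal_density)
  interpret NN: pair_prob_space std_normal_distribution std_normal_distribution ..
  have [measurable]: "plane_point \<in> borel_measurable (std_normal_distribution \<Otimes>\<^sub>M std_normal_distribution)"
    using measurable_Complex_scaled by (simp add: plane_point_def[abs_def] case_prod_beta)
  have "(\<integral>\<^sup>+z. f z \<partial>complex_std_gaussian) =
      (\<integral>\<^sup>+p. f (plane_point p) \<partial>(std_normal_distribution \<Otimes>\<^sub>M std_normal_distribution))"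
    unfolding complex_std_gaussian_def
    by (subst nn_integral_distr) (auto simp: plane_point_def case_prod_beta)
  also have "\<dots> = (\<integral>\<^sup>+x. \<integral>\<^sup>+y. f (plane_point (x, y)) \<partial>std_normal_distribution \<partial>std_normal_distribution)"
    by (subst N.nn_integral_fst[symmetric]) auto
  also have "\<dots> = (\<integral>\<^sup>+x. \<integral>\<^sup>+y. ?n x * (?n y * f (plane_point (x, y))) \<partial>lborel \<partial>lborel)"
    by (simp add: nn_integral_density nn_integral_cmult)
  also have "\<dots> = (\<integral>\<^sup>+p. ennreal (exp (- (cmod (plane_point p))\<^sup>2) / (2 * pi)) * f (plane_point p)
      \<partial>(lborel \<Otimes>\<^sub>M lborel))"
    unfolding dens by (subst lborel.nn_integral_fst[symmetric]) auto
  finally show ?thesis by (simp add: lborel_prod)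
qed

lemma complex_std_gaussian_pair_unitary:
  assumes f[measurable]: "case_prod f \<in> borel_measurable (borel \<Otimes>\<^sub>M borel)"
    and cs: "c * cnj c + s * cnj s = 1"
  shows "(\<integral>\<^sup>+z. \<integral>\<^sup>+w. f (c * z - cnj s * w) (s * z + cnj c * w)
      \<partial>complex_std_gaussian \<partial>complex_std_gaussian) =
    (\<integral>\<^sup>+z. \<integral>\<^sup>+w. f z w \<partial>complex_std_gaussian \<partial>complex_std_gaussian)"
proof -
  interpret G: prob_space complex_std_gaussian by (rule prob_space_complex_std_gaussian)
  define d where "d z w = ennreal (exp (- ((cmod z)\<^sup>2 + (cmod w)\<^sup>2)) / (2 * pi)\<^sup>2)" for z w
  have [measurable]: "case_prod d \<in> borel_measurable (borel \<Otimes>\<^sub>M borel)"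
    unfolding d_def[abs_def] by measurable
  have gauss: "(\<integral>\<^sup>+z. \<integral>\<^sup>+w. g z w \<partial>complex_std_gaussian \<partial>complex_std_gaussian) =
      plane_pair_integral (\<lambda>z w. d z w * g z w)"
    if [measurable]: "case_prod g \<in> borel_measurable (borel \<Otimes>\<^sub>M borel)" for g
  proof -
    have d: "ennreal (exp (- (cmod z)\<^sup>2) / (2 * pi)) * (ennreal (exp (- (cmod w)\<^sup>2) / (2 * pi)) * a) =
        d z w * a" for z w a
    proof -
      have "exp (- (cmod z)\<^sup>2) / (2 * pi) * (exp (- (cmod w)\<^sup>2) / (2 * pi)) =
          exp (- (cmod z)\<^sup>2 + - (cmod w)\<^sup>2) / (2 * pi)\<^sup>2"
        by (simp only: exp_add power2_eq_square times_divide_times_eq)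
      then show ?thesis by (simp add: d_def flip: ennreal_mult' mult.assoc)
    qed
    have "(\<integral>\<^sup>+z. \<integral>\<^sup>+w. g z w \<partial>complex_std_gaussian \<partial>complex_std_gaussian) =
      (\<integral>\<^sup>+p. ennreal (exp (- (cmod (plane_point p))\<^sup>2) / (2 * pi)) *
        (\<integral>\<^sup>+w. g (plane_point p) w \<partial>complex_std_gaussian) \<partial>lborel)"
      by (rule complex_std_gaussian_nn_integral) measurable
    also have "\<dots> = plane_pair_integral (\<lambda>z w. d z w * g z w)"
      unfolding plane_pair_integral_def
      by (intro nn_integral_cong, subst complex_std_gaussian_nn_integral, measurable)
        (subst nn_integral_cmult[symmetric], measurable, simp only: d)
    finally show ?thesis .
  qed
  have "d (c * z - cnj s * w) (s * z + cnj c * w) = d z w" for z w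
  proof -
    have "complex_of_real ((cmod (c * z - cnj s * w))\<^sup>2 + (cmod (s * z + cnj c * w))\<^sup>2) =
        (c * cnj c + s * cnj s) * complex_of_real ((cmod z)\<^sup>2 + (cmod w)\<^sup>2)"
      by (simp add: complex_norm_square algebra_simps del: of_real_power)
    then show ?thesis unfolding cs d_def by (simp only: mult_1 of_real_eq_iff)
  qed
  note d = this
  have "(\<integral>\<^sup>+z. \<integral>\<^sup>+w. f (c * z - cnj s * w) (s * z + cnj c * w)
      \<partial>complex_std_gaussian \<partial>complex_std_gaussian) =
    plane_pair_integral (\<lambda>z w. d (c * z - cnj s * w) (s * z + cnj c * w) *
      f (c * z - cnj s * w) (s * z + cnj c * w))"
    unfolding d by (rule gauss) measurable
  also have "\<dots> = plane_pair_integral (\<lambda>z w. d z w * f z w)"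
    by (rule plane_pair_integral_unitary[OF _ cs, of "\<lambda>z w. d z w * f z w"]) measurable
  also have "\<dots> = (\<integral>\<^sup>+z. \<integral>\<^sup>+w. f z w \<partial>complex_std_gaussian \<partial>complex_std_gaussian)"
    by (rule gauss[symmetric]) measurable
  finally show ?thesis .
qed

text \<open>The case \<open>c = -1\<close>, \<open>s = 0\<close>, for a function of the first variable only.\<close>

lemma complex_std_gaussian_uminus:
  assumes [measurable]: "f \<in> borel_measurable borel"
  shows "(\<integral>\<^sup>+z. f (- z) \<partial>complex_std_gaussian) = (\<integral>\<^sup>+z. f z \<partial>complex_std_gaussian)"
proof -
  interpret G: prob_space complex_std_gaussian by (rule prob_space_complex_std_gaussian)
  show ?thesis
    using complex_std_gaussian_pair_unitary[of "\<lambda>z w. f z" "-1" 0] by (simp add: G.emeasure_space_1)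
qed

section \<open>Second moments of Gaussian sums\<close>

text \<open>For independent \<open>\<gamma>\<^sub>1, \<dots>, \<gamma>\<^sub>n\<close> and \<open>xs = [x\<^sub>1, \<dots>, x\<^sub>n]\<close> this is \<open>\<bbbE> \<parallel>y + \<Sum> \<gamma>\<^sub>i x\<^sub>i\<parallel>\<^sup>2\<close>, written
  as an iterated integral. The offset \<open>y\<close> is the value of the summands that are already fixed:
  as all statements below hold for every offset, they may be applied to the tail of a list under
  the integral over its head.\<close>

primrec gauss_moment :: "'x::complex_normed_vector list \<Rightarrow> 'x \<Rightarrow> ennreal" where
  "gauss_moment [] y = ennreal ((norm y)\<^sup>2)"
| "gauss_moment (x # xs) y = (\<integral>\<^sup>+z. gauss_moment xs (y + z *\<^sub>C x) \<partial>complex_std_gaussian)"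

lemma continuous_on_scaleC_const [continuous_intros]:
  assumes "continuous_on A c"
  shows "continuous_on A (\<lambda>t. c t *\<^sub>C (x::'x::complex_normed_vector))"
  by (rule continuous_on_compose2[OF continuous_scaleC_left[of UNIV] assms]) auto

text \<open>The target space need not be second countable, hence sums of measurable maps into it need not be
  measurable. The way out is to regard the moment as a function of the finitely many scalar
  coefficients. Every further integration variable becomes one more coordinate; this is why the
  coefficients are taken from one fixed space of sequences.\<close>

lemma measurable_gauss_moment_coordinates:
  fixes y :: "'x::complex_normed_vector"
  shows "(\<lambda>c. gauss_moment xs (y + (\<Sum>i<n. c i *\<^sub>C x i))) \<in>
    borel_measurable (Pi\<^sub>M UNIV (\<lambda>_::nat. borel))"
proof (induction xs arbitrary: n x)
  case Nil
  have "(\<lambda>c::nat \<Rightarrow> complex. (norm (y + (\<Sum>i<n. c i *\<^sub>C x i)))\<^sup>2) \<in> borel_measurable borel"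
    by (intro borel_measurable_continuous_onI continuous_intros) auto
  then have "(\<lambda>c::nat \<Rightarrow> complex. (norm (y + (\<Sum>i<n. c i *\<^sub>C x i)))\<^sup>2) \<in>
      borel_measurable (Pi\<^sub>M UNIV (\<lambda>_::nat. borel))"
    by (simp cong: measurable_cong_sets add: measurable_cong_sets[OF sets_PiM_equal_borel refl])
  then show ?case by simp
next
  case (Cons x' xs)
  interpret G: prob_space complex_std_gaussian by (rule prob_space_complex_std_gaussian)
  let ?P = "Pi\<^sub>M UNIV (\<lambda>_::nat. borel) :: (nat \<Rightarrow> complex) measure"
  have [measurable]: "(\<lambda>c. gauss_moment xs (y + (\<Sum>i<Suc n. c i *\<^sub>C (x(n := x')) i))) \<in> borel_measurable ?P"
    by (rule Cons.IH)
  have [measurable]: "(\<lambda>(c, z). c(n := z)) \<in> ?P \<Otimes>\<^sub>M complex_std_gaussian \<rightarrow>\<^sub>M ?P"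
    by (rule measurable_PiM_single') (auto simp: case_prod_beta)
  have "(\<lambda>(c, z). gauss_moment xs (y + (\<Sum>i<Suc n. (case (c, z) of (c, z) \<Rightarrow> c(n := z)) i *\<^sub>C (x(n := x')) i)))
      \<in> borel_measurable (?P \<Otimes>\<^sub>M complex_std_gaussian)"
    by measurable
  moreover have "(\<Sum>i<Suc n. (c(n := z)) i *\<^sub>C (x(n := x')) i) = (\<Sum>i<n. c i *\<^sub>C x i) + z *\<^sub>C x'" for c z
    by simp
  ultimately have "(\<lambda>(c, z). gauss_moment xs (y + (\<Sum>i<n. c i *\<^sub>C x i) + z *\<^sub>C x'))
      \<in> borel_measurable (?P \<Otimes>\<^sub>M complex_std_gaussian)"
    by (simp add: add.assoc)
  then show ?case by (simp add: G.borel_measurable_nn_integral)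
qed

lemma measurable_gauss_moment:
  assumes A: "finite A" and c: "\<And>i. i \<in> A \<Longrightarrow> c i \<in> borel_measurable M"
  shows "(\<lambda>\<omega>. gauss_moment xs (y + (\<Sum>i\<in>A. c i \<omega> *\<^sub>C x i))) \<in> borel_measurable M"
proof -
  obtain b and n :: nat where b: "bij_betw b {..<n} A"
    using ex_bij_betw_nat_finite[OF A] by (auto simp: atLeast0LessThan)
  then have mem: "b i \<in> A" if "i < n" for i using that by (auto simp: bij_betw_def)
  have "(\<lambda>\<omega> i. if i < n then c (b i) \<omega> else 0) \<in> M \<rightarrow>\<^sub>M Pi\<^sub>M UNIV (\<lambda>_::nat. borel)"
  proof (rule measurable_PiM_single')
    show "(\<lambda>\<omega>. if i < n then c (b i) \<omega> else 0) \<in> borel_measurable M" for i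
      by (cases "i < n") (simp_all add: c mem)
  qed simp
  from measurable_compose[OF this measurable_gauss_moment_coordinates[where n = n and x = "\<lambda>i. x (b i)"]]
  show ?thesis by (simp add: sum.reindex_bij_betw[OF b, symmetric])
qed

lemma measurable_gauss_moment_line [measurable]:
  "(\<lambda>z. gauss_moment xs (y + z *\<^sub>C x)) \<in> borel_measurable borel"
  using measurable_gauss_moment[of "{()}" "\<lambda>_ z. z" borel xs y "\<lambda>_. x"] by simp

lemma measurable_gauss_moment_plane [measurable]:
  "(\<lambda>(z, w). gauss_moment us (y + z *\<^sub>C v + w *\<^sub>C w')) \<in> borel_measurable (borel \<Otimes>\<^sub>M borel)"
proof -
  let ?c = "\<lambda>b p. if b then fst p else snd p"
  have "(\<lambda>p. gauss_moment us (y + (\<Sum>b\<in>UNIV. ?c b p *\<^sub>C (if b then v else w')))) \<in>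
      borel_measurable (borel \<Otimes>\<^sub>M borel)"
    by (rule measurable_gauss_moment) (auto split: if_splits)
  then show ?thesis by (simp add: UNIV_bool case_prod_beta add.assoc add.commute[of "snd _ *\<^sub>C _"])
qed

text \<open>Midpoint convexity is inherited from the function \<open>\<parallel>y\<parallel>\<^sup>2\<close>.\<close>

lemma gauss_moment_midpoint:
  "2 * gauss_moment xs y \<le> gauss_moment xs (y + v) + gauss_moment xs (y - v)"
proof (induction xs arbitrary: y)
  case Nil
  have "2 * norm y \<le> norm (y + v) + norm (y - v)"
    using norm_triangle_ineq[of "y + v" "y - v"] by (simp flip: scaleR_2)
  then have "(2 * norm y)\<^sup>2 \<le> (norm (y + v) + norm (y - v))\<^sup>2" by (intro power_mono) auto
  also have "\<dots> \<le> 2 * ((norm (y + v))\<^sup>2 + (norm (y - v))\<^sup>2)"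
    using sum_squares_ge_zero by (smt (verit) power2_sum sum_squares_bound)
  finally have "2 * (norm y)\<^sup>2 \<le> (norm (y + v))\<^sup>2 + (norm (y - v))\<^sup>2"
    by (simp add: power_mult_distrib)
  then have "ennreal (2 * (norm y)\<^sup>2) \<le> ennreal ((norm (y + v))\<^sup>2 + (norm (y - v))\<^sup>2)"
    by (rule ennreal_leI)
  then show ?case by (simp add: ennreal_mult' ennreal_plus)
next
  case (Cons x xs)
  have "2 * gauss_moment (x # xs) y = (\<integral>\<^sup>+z. 2 * gauss_moment xs (y + z *\<^sub>C x) \<partial>complex_std_gaussian)"
    by (simp add: nn_integral_cmult)
  also have "\<dots> \<le> (\<integral>\<^sup>+z. gauss_moment xs ((y + v) + z *\<^sub>C x) + gauss_moment xs ((y - v) + z *\<^sub>C x) \<partial>complex_std_gaussian)"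
    using Cons.IH[of "y + _ *\<^sub>C x"] by (intro nn_integral_mono) (simp add: algebra_simps)
  also have "\<dots> = gauss_moment (x # xs) (y + v) + gauss_moment (x # xs) (y - v)"
    by (simp add: nn_integral_add)
  finally show ?case .
qed

text \<open>A symmetric random offset \<open>z x\<close> is as likely as \<open>- z x\<close>, so that convexity can be averaged over
  \<open>z\<close>.\<close>

lemma gauss_moment_le_Cons: "gauss_moment xs y \<le> gauss_moment (x # xs) y"
proof -
  interpret G: prob_space complex_std_gaussian by (rule prob_space_complex_std_gaussian)
  have "2 * gauss_moment xs y = (\<integral>\<^sup>+z. 2 * gauss_moment xs y \<partial>complex_std_gaussian)"
    by (simp add: G.emeasure_space_1)
  also have "\<dots> \<le> (\<integral>\<^sup>+z. gauss_moment xs (y + z *\<^sub>C x) + gauss_moment xs (y + - z *\<^sub>C x) \<partial>complex_std_gaussian)"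
    using gauss_moment_midpoint[of xs y "_ *\<^sub>C x"]
    by (intro nn_integral_mono) (simp add: scaleC_minus_left)
  also have "\<dots> = gauss_moment (x # xs) y + (\<integral>\<^sup>+z. gauss_moment xs (y + - z *\<^sub>C x) \<partial>complex_std_gaussian)"
    by (simp add: nn_integral_add)
  also have "(\<integral>\<^sup>+z. gauss_moment xs (y + - z *\<^sub>C x) \<partial>complex_std_gaussian) = gauss_moment (x # xs) y"
    using complex_std_gaussian_uminus[OF measurable_gauss_moment_line[of xs y x]] by simp
  finally show ?thesis
    by (simp add: mult_2[symmetric] ennreal_mult_le_mult_iff)
qed

lemma gauss_moment_Nil_le: "gauss_moment [] y \<le> gauss_moment xs y"
proof (induction xs)
  case (Cons x xs)
  then show ?case using gauss_moment_le_Cons[of xs y x] by (rule order_trans)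
qed simp

text \<open>With \<open>(z, w)\<close> also \<open>(c z - cnj s w, s z + cnj c w)\<close> is a pair of independent standard Gaussians.\<close>

lemma gauss_moment_rotate:
  assumes cs: "c * cnj c + s * cnj s = 1"
  shows "gauss_moment ((c *\<^sub>C v + s *\<^sub>C w) # (cnj c *\<^sub>C w - cnj s *\<^sub>C v) # us) y = gauss_moment (v # w # us) y"
proof -
  have "y + a *\<^sub>C (c *\<^sub>C v + s *\<^sub>C w) + b *\<^sub>C (cnj c *\<^sub>C w - cnj s *\<^sub>C v) =
      y + (c * a - cnj s * b) *\<^sub>C v + (s * a + cnj c * b) *\<^sub>C w" for a b
    by (simp add: scaleC_add_right scaleC_diff_right scaleC_add_left scaleC_diff_left scaleC_scaleC mult.commute algebra_simps)
  then show ?thesis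
    using complex_std_gaussian_pair_unitary[OF measurable_gauss_moment_plane cs, of us y v w]
    by (simp only: gauss_moment.simps)
qed

section \<open>Givens rotations of lists of vectors\<close>

fun lincomb :: "complex list \<Rightarrow> 'a::complex_vector list \<Rightarrow> 'a" where
  "lincomb (c # cs) (v # vs) = c *\<^sub>C v + lincomb cs vs"
| "lincomb _ _ = 0"

text \<open>The map that sends the standard basis of \<open>\<complex>\<^sup>n\<close> to the list is a contraction.\<close>

definition contractive :: "'a::complex_normed_vector list \<Rightarrow> bool"
  where "contractive vs \<longleftrightarrow>
    (\<forall>cs. length cs = length vs \<longrightarrow> (norm (lincomb cs vs))\<^sup>2 \<le> (\<Sum>c\<leftarrow>cs. (cmod c)\<^sup>2))"

text \<open>Two lists are related if they arise from each other by a unitary matrix which is a product of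
  rotations of two neighbouring entries. Rotating the head of some tail is enough for the
  elimination below.\<close>

inductive givens :: "'a::complex_vector list \<Rightarrow> 'a list \<Rightarrow> bool" where
  refl: "givens vs vs"
| rotate: "c * cnj c + s * cnj s = 1 \<Longrightarrow>
    givens (v # w # us) ((c *\<^sub>C v + s *\<^sub>C w) # (cnj c *\<^sub>C w - cnj s *\<^sub>C v) # us)"
| Cons: "givens us vs \<Longrightarrow> givens (v # us) (v # vs)"
| trans: "givens us vs \<Longrightarrow> givens vs ws \<Longrightarrow> givens us ws"

lemma gauss_moment_givens:
  assumes S: "clinear S" and "givens us vs"
  shows "gauss_moment (map S us) y = gauss_moment (map S vs) y"
  using assms(2)
proof (induction arbitrary: y rule: givens.induct)
  case (rotate c s v w us)
  have "S (c *\<^sub>C v + s *\<^sub>C w) = c *\<^sub>C S v + s *\<^sub>C S w"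
    using S by (simp add: clinear_def)
  moreover have "S (cnj c *\<^sub>C w - cnj s *\<^sub>C v) = cnj c *\<^sub>C S w - cnj s *\<^sub>C S v"
    using S by (simp add: clinear_diff clinear_def)
  ultimately show ?case
    using gauss_moment_rotate[OF rotate, of "S v" "S w" "map S us" y] by (simp only: list.map)
qed simp_all

lemma givens_subspace: "givens us vs \<Longrightarrow> csubspace V \<Longrightarrow> set us \<subseteq> V \<Longrightarrow> set vs \<subseteq> V"
proof (induction rule: givens.induct)
  case (rotate c s v w us)
  then show ?case using csubspace_diff[of V "cnj c *\<^sub>C w" "cnj s *\<^sub>C v"] by (simp add: csubspace_def)
qed auto

lemma givens_lincomb:
  "givens us vs \<Longrightarrow> length cs = length vs \<Longrightarrow>
    \<exists>ds. length ds = length us \<and> lincomb ds us = lincomb cs vs \<and>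
      (\<Sum>c\<leftarrow>ds. (cmod c)\<^sup>2) = (\<Sum>c\<leftarrow>cs. (cmod c)\<^sup>2)"
proof (induction arbitrary: cs rule: givens.induct)
  case (rotate c s v w us)
  then obtain a b rs where cs: "cs = a # b # rs" "length rs = length us"
    by (auto simp: length_Suc_conv)
  let ?a = "c * a - cnj s * b" and ?b = "s * a + cnj c * b"
  have "complex_of_real ((cmod ?a)\<^sup>2 + (cmod ?b)\<^sup>2) =
      (c * cnj c + s * cnj s) * complex_of_real ((cmod a)\<^sup>2 + (cmod b)\<^sup>2)"
    by (simp add: complex_norm_square algebra_simps del: of_real_power)
  then have "(cmod ?a)\<^sup>2 + (cmod ?b)\<^sup>2 = (cmod a)\<^sup>2 + (cmod b)\<^sup>2"
    unfolding rotate by (simp only: mult_1 of_real_eq_iff)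
  moreover have "?a *\<^sub>C v + ?b *\<^sub>C w = a *\<^sub>C (c *\<^sub>C v + s *\<^sub>C w) + b *\<^sub>C (cnj c *\<^sub>C w - cnj s *\<^sub>C v)"
    by (simp add: scaleC_diff_left scaleC_add_right scaleC_diff_right scaleC_add_left scaleC_minus_left scaleC_scaleC mult.commute algebra_simps)
  ultimately show ?case
    using cs by (intro exI[of _ "?a # ?b # rs"]) (simp add: add.assoc[symmetric])
next
  case (Cons us vs v)
  then obtain a rs where cs: "cs = a # rs" "length rs = length vs"
    by (auto simp: length_Suc_conv)
  from Cons.IH[OF cs(2)] obtain ds where "length ds = length us" "lincomb ds us = lincomb rs vs"
      "(\<Sum>c\<leftarrow>ds. (cmod c)\<^sup>2) = (\<Sum>c\<leftarrow>rs. (cmod c)\<^sup>2)" by blast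
  then show ?case using cs by (intro exI[of _ "a # ds"]) simp
next
  case (trans us vs ws)
  then show ?case by metis
qed auto

lemma givens_contractive: "givens us vs \<Longrightarrow> contractive us \<Longrightarrow> contractive vs"
  unfolding contractive_def by (metis givens_lincomb)

text \<open>This is the elimination step of a QR decomposition. Working from the end of the list, the
  component along \<open>f\<close> is pushed from each entry into its left neighbour.\<close>

lemma givens_eliminate:
  fixes f :: "'a::complex_inner"
  shows "\<exists>w us. givens (v # vs) (w # us) \<and> (\<forall>u\<in>set us. cinner u f = 0)"
proof (induction vs arbitrary: v)
  case Nil
  then show ?case using givens.refl[of "[v]"] by fastforce
next
  case (Cons v' vs)
  then obtain w us where w: "givens (v' # vs) (w # us)" "\<forall>u\<in>set us. cinner u f = 0" by blast
  then have *: "givens (v # v' # vs) (v # w # us)" by (blast intro: givens.Cons)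
  define p q r where "p = cinner v f" and "q = cinner w f" and "r = sqrt ((cmod p)\<^sup>2 + (cmod q)\<^sup>2)"
  show ?case
  proof (cases "r = 0")
    case True
    then have "q = 0" by (simp add: r_def add_nonneg_eq_0_iff)
    then show ?thesis using * w(2) q_def by (intro exI[of _ v] exI[of _ "w # us"]) simp
  next
    case False
    \<comment> \<open>For these coefficients \<open>cnj c * q - cnj s * p\<close>, the new component of the second entry along
      \<open>f\<close>, vanishes.\<close>
    let ?c = "cnj p / r" and ?s = "cnj q / r"
    have "complex_of_real (r\<^sup>2) = complex_of_real ((cmod p)\<^sup>2 + (cmod q)\<^sup>2)" by (simp add: r_def)
    also have "\<dots> = p * cnj p + q * cnj q" by (simp add: complex_norm_square del: of_real_power)
    finally have r: "p * cnj p + q * cnj q = complex_of_real (r * r)" by (simp add: power2_eq_square)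
    have "?c * cnj ?c + ?s * cnj ?s = (p * cnj p + q * cnj q) / complex_of_real (r * r)"
      by (simp add: add_divide_distrib mult.commute)
    also have "\<dots> = 1" unfolding r using False by simp
    finally have "?c * cnj ?c + ?s * cnj ?s = 1" .
    from givens.rotate[OF this, of v w us] *
    have "givens (v # v' # vs) ((?c *\<^sub>C v + ?s *\<^sub>C w) # (cnj ?c *\<^sub>C w - cnj ?s *\<^sub>C v) # us)"
      by (blast intro: givens.trans)
    moreover have "cinner (cnj ?c *\<^sub>C w - cnj ?s *\<^sub>C v) f = 0"
      by (simp add: cinner_diff_left cinner_scaleC_left p_def[symmetric] q_def[symmetric])
    ultimately show ?thesis using w(2) by fastforce
  qed
qed

section \<open>Comparison with an orthonormal system\<close>

lemma lincomb_replicate_zero: "lincomb (replicate n 0) vs = 0"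
  by (induction n arbitrary: vs; case_tac vs) simp_all

text \<open>Let \<open>u\<close> be the part of \<open>v\<close> orthogonal to \<open>f\<close>. In the contraction condition the component along
  \<open>f\<close> contributes \<open>|\<alpha> c|\<^sup>2\<close>, where \<open>c\<close> is the coefficient of \<open>v\<close>; this can be moved to the other
  side, and what remains is a contraction condition in which \<open>|c|\<^sup>2\<close> has the weight
  \<open>\<beta>\<^sup>2 = 1 - |\<alpha>|\<^sup>2\<close>. Replacing \<open>u\<close> by \<open>u / \<beta>\<close> restores the weight \<open>1\<close>. If \<open>\<beta> = 0\<close>, then \<open>u = 0\<close>, and
  the convention \<open>1 / 0 = 0\<close> yields the right vector \<open>w = 0\<close>.\<close>

lemma contractive_split:
  fixes f :: "'h::complex_inner"
  assumes con: "contractive (v # us)" and f: "norm f = 1" and us: "\<forall>u\<in>set us. cinner u f = 0"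
    and V: "csubspace V" "v \<in> V" "f \<in> V"
  obtains \<alpha> w and \<beta> :: real where "v = \<alpha> *\<^sub>C f + complex_of_real \<beta> *\<^sub>C w"
    "(cmod \<alpha>)\<^sup>2 + \<beta>\<^sup>2 = 1" "cinner w f = 0" "w \<in> V" "contractive (w # us)"
proof -
  define \<alpha> where "\<alpha> = cinner v f"
  define u where "u = v - \<alpha> *\<^sub>C f"
  have v: "v = \<alpha> *\<^sub>C f + u" by (simp add: u_def)
  have uf: "cinner u f = 0" using f by (simp add: u_def \<alpha>_def cinner_diff_left cinner_scaleC_left cinner_norm)
  have lin: "cinner (lincomb cs us) f = 0" for cs
    using us by (induction cs us rule: lincomb.induct) (simp_all add: cinner_add_left cinner_scaleC_left)
  have bound: "(norm (c *\<^sub>C u + lincomb cs us))\<^sup>2 \<le> (1 - (cmod \<alpha>)\<^sup>2) * (cmod c)\<^sup>2 + (\<Sum>c\<leftarrow>cs. (cmod c)\<^sup>2)"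
    if "length cs = length us" for c cs
  proof -
    have "(norm (lincomb (c # cs) (v # us)))\<^sup>2 \<le> (cmod c)\<^sup>2 + (\<Sum>c\<leftarrow>cs. (cmod c)\<^sup>2)"
      using con[unfolded contractive_def, rule_format, of "c # cs"] that by simp
    moreover have "lincomb (c # cs) (v # us) = (c *\<^sub>C u + lincomb cs us) + (c * \<alpha>) *\<^sub>C f"
      unfolding lincomb.simps v scaleC_add_right scaleC_scaleC by simp
    moreover have "cinner (c *\<^sub>C u + lincomb cs us) ((c * \<alpha>) *\<^sub>C f) = 0"
      by (simp add: cinner_add_left cinner_scaleC_left cinner_scaleC_right uf lin)
    moreover have "(norm ((c * \<alpha>) *\<^sub>C f))\<^sup>2 = (cmod \<alpha>)\<^sup>2 * (cmod c)\<^sup>2"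
      by (simp add: norm_scaleC norm_mult f power_mult_distrib mult.commute)
    ultimately show ?thesis
      by (simp only: norm_pythagoras left_diff_distrib)
  qed
  define \<beta> where "\<beta> = sqrt (1 - (cmod \<alpha>)\<^sup>2)"
  have u_le: "(norm u)\<^sup>2 \<le> 1 - (cmod \<alpha>)\<^sup>2"
    using bound[of "replicate (length us) 0" 1] by (simp add: lincomb_replicate_zero sum_list_replicate map_replicate)
  then have nn: "0 \<le> 1 - (cmod \<alpha>)\<^sup>2" by (rule order_trans[rotated]) simp
  then have \<beta>: "\<beta>\<^sup>2 = 1 - (cmod \<alpha>)\<^sup>2" by (simp add: \<beta>_def)
  define w where "w = complex_of_real (1 / \<beta>) *\<^sub>C u"
  have \<beta>w: "complex_of_real \<beta> *\<^sub>C w = u"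
    using u_le \<beta> by (cases "\<beta> = 0") (simp_all add: w_def scaleC_scaleC)
  have "contractive (w # us)"
    unfolding contractive_def
  proof (intro allI impI)
    fix cs :: "complex list" assume "length cs = length (w # us)"
    then obtain c ds where cs: "cs = c # ds" "length ds = length us" by (auto simp: length_Suc_conv)
    let ?c = "c * complex_of_real (1 / \<beta>)"
    have "(norm (lincomb cs (w # us)))\<^sup>2 = (norm (?c *\<^sub>C u + lincomb ds us))\<^sup>2"
      by (simp add: cs w_def scaleC_scaleC)
    also have "\<dots> \<le> \<beta>\<^sup>2 * (cmod ?c)\<^sup>2 + (\<Sum>c\<leftarrow>ds. (cmod c)\<^sup>2)"
      using bound[OF cs(2)] by (simp only: \<beta>)
    also have "\<beta>\<^sup>2 * (cmod ?c)\<^sup>2 \<le> (cmod c)\<^sup>2"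
      by (cases "\<beta> = 0") (simp_all add: norm_mult norm_divide power_mult_distrib power_divide)
    finally show "(norm (lincomb cs (w # us)))\<^sup>2 \<le> (\<Sum>c\<leftarrow>cs. (cmod c)\<^sup>2)"
      by (simp add: cs)
  qed
  moreover have "w \<in> V"
    using V csubspace_diff[of V v "\<alpha> *\<^sub>C f"] by (simp add: w_def u_def csubspace_def)
  moreover have "cinner w f = 0" by (simp add: w_def cinner_scaleC_left uf)
  ultimately show thesis using that[of \<alpha> \<beta> w] v \<beta>w \<beta> by simp
qed

lemma gauss_moment_zeros:
  "(\<forall>x\<in>set xs. x = 0) \<Longrightarrow> gauss_moment xs y = gauss_moment [] y"
proof (induction xs)
  case (Cons x xs)
  interpret G: prob_space complex_std_gaussian by (rule prob_space_complex_std_gaussian)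
  show ?case using Cons by (simp add: G.emeasure_space_1)
qed simp

text \<open>The covariance of \<open>\<Sum> \<gamma>\<^sub>i v\<^sub>i\<close> is dominated by that of \<open>\<Sum> \<gamma>\<^sub>j f\<^sub>j\<close>, and Gaussian second moments
  are monotone in the covariance. The proof realises this by peeling off one \<open>f\<close> at a time.\<close>

lemma gauss_moment_contractive:
  fixes S :: "'h::complex_inner \<Rightarrow> 'x::complex_normed_vector"
  assumes S: "clinear S"
  shows "distinct fs \<Longrightarrow> orthonormal (set fs) \<Longrightarrow> contractive vs \<Longrightarrow> set vs \<subseteq> ortho_span (set fs) \<Longrightarrow>
    gauss_moment (map S vs) y \<le> gauss_moment (map S fs) y"
proof (induction fs arbitrary: vs y)
  case Nil
  have S0: "S 0 = 0" using clinear_diff[OF S, of 0 0] by simp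
  have "\<forall>x\<in>set (map S vs). x = 0"
    using Nil S0 by (auto simp: ortho_span_def)
  then show ?case using gauss_moment_zeros[of "map S vs" y] by simp
next
  case (Cons f fs)
  have f: "norm f = 1" "f \<notin> set fs" and ff: "\<And>g. g \<in> set fs \<Longrightarrow> cinner f g = 0"
    using Cons.prems orthonormal_norm[of "set (f # fs)" f] by (auto simp: orthonormal_def)
  show ?case
  proof (cases vs)
    case Nil
    then show ?thesis using gauss_moment_Nil_le[of y "map S (f # fs)"] by simp
  next
    case (Cons v0 vs0)
    obtain v us where giv: "givens vs (v # us)" and us: "\<forall>u\<in>set us. cinner u f = 0"
      using givens_eliminate[of v0 vs0 f] Cons by blast
    let ?V = "ortho_span (set (f # fs))"
    have sub: "set (v # us) \<subseteq> ?V"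
      using givens_subspace[OF giv csubspace_ortho_span] Cons.prems by blast
    have V: "v \<in> ?V" "f \<in> ?V" using sub f ff by (simp_all add: ortho_span_def cinner_norm)
    obtain \<alpha> w \<beta> where v: "v = \<alpha> *\<^sub>C f + complex_of_real \<beta> *\<^sub>C w"
      and ab: "(cmod \<alpha>)\<^sup>2 + \<beta>\<^sup>2 = 1" and w: "cinner w f = 0" "w \<in> ?V" "contractive (w # us)"
      by (rule contractive_split[OF givens_contractive[OF giv Cons.prems(3)] f(1) us csubspace_ortho_span V])
    have sub': "set (w # us) \<subseteq> ortho_span (set fs)"
      using sub us w f(2) by (auto simp: ortho_span_insert)
    have "complex_of_real ((cmod \<alpha>)\<^sup>2 + \<beta>\<^sup>2) = 1" using ab by simp
    then have cs: "\<alpha> * cnj \<alpha> + complex_of_real \<beta> * cnj (complex_of_real \<beta>) = 1"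
      unfolding of_real_add complex_norm_square by (simp add: power2_eq_square)
    have Sv: "S v = \<alpha> *\<^sub>C S f + complex_of_real \<beta> *\<^sub>C S w"
      using S by (simp add: v clinear_def)
    have "gauss_moment (map S vs) y = gauss_moment (S v # map S us) y"
      using gauss_moment_givens[OF S giv] by simp
    \<comment> \<open>The unitary mixture that turns \<open>f\<close> into \<open>v\<close> turns \<open>w\<close> into the vector inserted here.\<close>
    also have "\<dots> \<le> gauss_moment (S v # (cnj \<alpha> *\<^sub>C S w - cnj (complex_of_real \<beta>) *\<^sub>C S f) # map S us) y"
      unfolding gauss_moment.simps(2)[of "S v"] by (intro nn_integral_mono gauss_moment_le_Cons)
    also have "\<dots> = gauss_moment (S f # map S (w # us)) y"
      unfolding Sv gauss_moment_rotate[OF cs] by simp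
    also have "\<dots> \<le> gauss_moment (map S (f # fs)) y"
      unfolding list.simps(9)[of S f] gauss_moment.simps(2)[of "S f"]
      using Cons.prems sub' w(3) by (intro nn_integral_mono Cons.IH) (auto simp: orthonormal_def)
    finally show ?thesis .
  qed
qed

section \<open>The ideal property of gamma norms\<close>

text \<open>The moments are the squares of the norms that enter \<open>\<parallel>S\<parallel>\<^sub>\<gamma>\<close>: Fubini's theorem on the product
  space, one coordinate at a time.\<close>

lemma gauss_moment_PiM:
  fixes S :: "'i \<Rightarrow> 'x::complex_normed_vector"
  assumes "distinct es"
  shows "(\<integral>\<^sup>+\<omega>. ennreal ((norm (y + (\<Sum>e\<in>set es. \<omega> e *\<^sub>C S e)))\<^sup>2) \<partial>Pi\<^sub>M (set es) (\<lambda>_. complex_std_gaussian)) =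
    gauss_moment (map S es) y"
  using assms
proof (induction es arbitrary: y)
  case Nil
  show ?case by (simp add: PiM_empty nn_integral_count_space_finite)
next
  case (Cons e es)
  interpret product_sigma_finite "\<lambda>_::'i. complex_std_gaussian"
    by (rule product_sigma_finite.intro)
      (rule prob_space_imp_sigma_finite[OF prob_space_complex_std_gaussian])
  let ?f = "\<lambda>\<omega>. ennreal ((norm (y + (\<Sum>e\<in>set (e # es). \<omega> e *\<^sub>C S e)))\<^sup>2)"
  have "?f \<in> borel_measurable (Pi\<^sub>M (set (e # es)) (\<lambda>_. complex_std_gaussian))"
    using measurable_gauss_moment[of "set (e # es)" "\<lambda>e \<omega>. \<omega> e" "Pi\<^sub>M (set (e # es)) (\<lambda>_. complex_std_gaussian)" "[]" y S]
    by (simp del: set_simps)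
  then have "(\<integral>\<^sup>+\<omega>. ?f \<omega> \<partial>Pi\<^sub>M (set (e # es)) (\<lambda>_. complex_std_gaussian)) =
      (\<integral>\<^sup>+z. \<integral>\<^sup>+\<omega>. ?f (fun_upd \<omega> e z) \<partial>Pi\<^sub>M (set es) (\<lambda>_. complex_std_gaussian) \<partial>complex_std_gaussian)"
    using Cons.prems by (simp add: product_nn_integral_insert_rev)
  also have "\<dots> = (\<integral>\<^sup>+z. \<integral>\<^sup>+\<omega>. ennreal ((norm ((y + z *\<^sub>C S e) + (\<Sum>e\<in>set es. \<omega> e *\<^sub>C S e)))\<^sup>2)
      \<partial>Pi\<^sub>M (set es) (\<lambda>_. complex_std_gaussian) \<partial>complex_std_gaussian)"
  proof -
    have "(\<Sum>e'\<in>set es. (fun_upd \<omega> e z) e' *\<^sub>C S e') = (\<Sum>e\<in>set es. \<omega> e *\<^sub>C S e)" for \<omega> z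
      using Cons.prems by (intro sum.cong) auto
    then have "y + (\<Sum>e'\<in>set (e # es). (fun_upd \<omega> e z) e' *\<^sub>C S e') =
        (y + z *\<^sub>C S e) + (\<Sum>e\<in>set es. \<omega> e *\<^sub>C S e)" for \<omega> z
      using Cons.prems by (simp add: add.assoc)
    then show ?thesis by (simp only:)
  qed
  also have "\<dots> = gauss_moment (map S (e # es)) y"
    using Cons by simp
  finally show ?case .
qed

lemma gauss_sum_norm_nonneg: "0 \<le> gauss_sum_norm B S"
  by (simp add: gauss_sum_norm_def)

lemma gauss_sum_norm_eq_gauss_moment:
  assumes "distinct es"
  shows "ennreal ((gauss_sum_norm (set es) S)\<^sup>2) = gauss_moment (map S es) 0"
  using gauss_moment_PiM[OF assms, of 0 S]
    nn_integral_eq_integral[OF integrable_gauss_sum[of "set es" S]]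
  by (simp add: gauss_sum_norm_def integral_nonneg_AE)

lemma clinear_lincomb: "clinear T \<Longrightarrow> T (lincomb cs vs) = lincomb cs (map T vs)"
  using clinear_diff[of T 0 0]
  by (induction cs vs rule: lincomb.induct) (simp_all add: clinear_def)

lemma norm_lincomb_orthonormal:
  assumes "distinct es" "orthonormal (set es)" "length cs = length es"
  shows "(norm (lincomb cs es))\<^sup>2 = (\<Sum>c\<leftarrow>cs. (cmod c)\<^sup>2)"
  using assms
proof (induction cs es rule: lincomb.induct)
  case (1 c cs e es)
  have "cinner (lincomb ds us) e = 0" if "\<forall>u\<in>set us. cinner u e = 0" for ds us
    using that by (induction ds us rule: lincomb.induct) (simp_all add: cinner_add_left cinner_scaleC_left)
  moreover have "\<forall>u\<in>set es. cinner u e = 0" using 1 by (auto simp: orthonormal_def)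
  ultimately have "cinner (lincomb cs es) (c *\<^sub>C e) = 0" by (simp add: cinner_scaleC_right)
  moreover have "orthonormal (set es)" using 1(3) by (simp add: orthonormal_def)
  ultimately show ?case
    using 1 norm_pythagoras[of "lincomb cs es" "c *\<^sub>C e"] orthonormal_norm[OF 1(3), of e]
    by (simp add: norm_scaleC add.commute)
qed auto

lemma gamma_norm_contraction:
  fixes S :: "'h::complex_inner \<Rightarrow> 'x::complex_normed_vector" and T :: "'k::complex_inner \<Rightarrow> 'h"
  assumes S: "clinear S" and T: "clinear T" "\<And>k. norm (T k) \<le> norm k"
  shows "gamma_norm (\<lambda>k. S (T k)) \<le> gamma_norm S"
  unfolding gamma_norm_def[of "\<lambda>k. S (T k)"]
proof (rule SUP_least)
  fix B :: "'k set"
  assume "B \<in> {B. finite B \<and> orthonormal B}"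
  then obtain es where es: "distinct es" "B = set es" "orthonormal (set es)"
    using finite_distinct_list[of B] by auto
  obtain fs where fs: "distinct fs" "orthonormal (set fs)" "set (map T es) \<subseteq> ortho_span (set fs)"
    using orthonormal_list_spanning by blast
  have "contractive (map T es)"
    unfolding contractive_def
  proof (intro allI impI)
    fix cs :: "complex list" assume "length cs = length (map T es)"
    then have norm: "(norm (lincomb cs es))\<^sup>2 = (\<Sum>c\<leftarrow>cs. (cmod c)\<^sup>2)"
      using norm_lincomb_orthonormal es by simp
    show "(norm (lincomb cs (map T es)))\<^sup>2 \<le> (\<Sum>c\<leftarrow>cs. (cmod c)\<^sup>2)"
      unfolding norm[symmetric] clinear_lincomb[OF T(1), symmetric] by (intro power_mono T(2)) simp
  qed
  from gauss_moment_contractive[OF S fs(1,2) this fs(3), of 0]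
  have "ennreal ((gauss_sum_norm B (\<lambda>k. S (T k)))\<^sup>2) \<le> ennreal ((gauss_sum_norm (set fs) S)\<^sup>2)"
    unfolding es(2) gauss_sum_norm_eq_gauss_moment[OF es(1)] gauss_sum_norm_eq_gauss_moment[OF fs(1)]
    by (simp add: comp_def)
  then have "(gauss_sum_norm B (\<lambda>k. S (T k)))\<^sup>2 \<le> (gauss_sum_norm (set fs) S)\<^sup>2"
    by (rule iffD1[OF ennreal_le_iff, rotated]) simp
  then have "gauss_sum_norm B (\<lambda>k. S (T k)) \<le> gauss_sum_norm (set fs) S"
    by (rule power2_le_imp_le) (rule gauss_sum_norm_nonneg)
  then show "ennreal (gauss_sum_norm B (\<lambda>k. S (T k))) \<le> gamma_norm S"
    unfolding gamma_norm_def using fs by (intro SUP_upper2[of "set fs"]) (auto intro: ennreal_leI)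
qed

lemma gauss_sum_norm_scaleC: "gauss_sum_norm B (\<lambda>h. c *\<^sub>C S h) = cmod c * gauss_sum_norm B S"
proof -
  have "norm (\<Sum>e\<in>B. \<omega> e *\<^sub>C c *\<^sub>C S e) = cmod c * norm (\<Sum>e\<in>B. \<omega> e *\<^sub>C S e)" for \<omega>
  proof -
    have "(\<Sum>e\<in>B. \<omega> e *\<^sub>C c *\<^sub>C S e) = c *\<^sub>C (\<Sum>e\<in>B. \<omega> e *\<^sub>C S e)"
      by (simp add: scaleC_sum_right scaleC_scaleC mult.commute)
    then show ?thesis by (simp add: norm_scaleC)
  qed
  then show ?thesis by (simp add: gauss_sum_norm_def power_mult_distrib real_sqrt_mult)
qed

lemma gamma_norm_scaleC: "gamma_norm (\<lambda>h. c *\<^sub>C S h) = ennreal (cmod c) * gamma_norm S"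
proof -
  have "{} \<in> {B :: 'a set. finite B \<and> orthonormal B}" by (simp add: orthonormal_def)
  then show ?thesis
    unfolding gamma_norm_def
    by (subst SUP_mult_left_ennreal) (simp_all add: gauss_sum_norm_scaleC ennreal_mult' gauss_sum_norm_nonneg)
qed

text \<open>A bound \<open>m > 0\<close> instead of \<open>\<parallel>T\<parallel>\<close> itself permits division by \<open>m\<close> also for \<open>T = 0\<close>.\<close>

lemma gamma_norm_compose_le:
  fixes S :: "'h::complex_inner \<Rightarrow> 'x::complex_normed_vector" and T :: "'k::complex_inner \<Rightarrow>\<^sub>C\<^sub>L 'h"
  assumes S: "clinear S" and m: "0 < m" "norm T \<le> m"
  shows "gamma_norm (\<lambda>k. S (T *\<^sub>V k)) \<le> ennreal m * gamma_norm S"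
proof -
  let ?T = "complex_of_real (1 / m) *\<^sub>C T"
  have "norm ?T \<le> 1" using m by (simp add: norm_scaleC norm_divide)
  then have "norm (?T *\<^sub>V k) \<le> norm k" for k
    using norm_cblinfun[of ?T k] mult_right_mono[of "norm ?T" 1 "norm k"] by simp
  from gamma_norm_contraction[OF S clinear_cblinfun_apply this]
  have "ennreal m * gamma_norm (\<lambda>k. S (?T *\<^sub>V k)) \<le> ennreal m * gamma_norm S"
    by (rule mult_left_mono) simp
  moreover have "complex_of_real m *\<^sub>C S (?T *\<^sub>V k) = S (T *\<^sub>V k)" for k
    using S m by (simp add: scaleC_cblinfun.rep_eq clinear_def scaleC_scaleC)
  moreover have "ennreal m * gamma_norm (\<lambda>k. S (?T *\<^sub>V k)) = gamma_norm (\<lambda>k. complex_of_real m *\<^sub>C S (?T *\<^sub>V k))"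
    using m by (simp only: gamma_norm_scaleC norm_of_real abs_of_pos)
  ultimately show ?thesis by simp
qed

lemma clinear_tensor_sum: "clinear (tensor_sum n g' x)"
  by (simp add: clinear_def tensor_sum_def cblinfun_add_right cblinfun_scaleC_right scaleC_add_left
      sum.distrib scaleC_sum_right scaleC_scaleC scaleC_complex_def)

lemma tensor_sum_compose:
  "tensor_sum n g' x (T *\<^sub>V k) = tensor_sum n (\<lambda>j. transpose_op T *\<^sub>V g' j) x k"
  by (simp add: tensor_sum_def cblinfun_compose.rep_eq)

text \<open>If \<open>U\<close> has finite rank and is close to \<open>S\<close>, then \<open>U \<circ> T\<close> has finite rank and is close to
  \<open>S \<circ> T\<close>.\<close>

lemma gamma_ops_compose:
  fixes S :: "'h::complex_inner \<Rightarrow> 'x::complex_normed_vector" and T :: "'k::complex_inner \<Rightarrow>\<^sub>C\<^sub>L 'h"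
  assumes "S \<in> gamma_ops"
  shows "(\<lambda>k. S (T *\<^sub>V k)) \<in> gamma_ops"
proof -
  have S: "clinear S" "gamma_norm S < \<infinity>"
    and approx: "\<And>\<epsilon>. \<epsilon> > 0 \<Longrightarrow> \<exists>U\<in>finite_rank_ops. gamma_norm U < \<infinity> \<and> gamma_norm (\<lambda>h. S h - U h) < \<epsilon>"
    using assms by (auto simp: gamma_ops_def)
  define m where "m = norm T + 1"
  have m: "0 < m" "norm T \<le> m" by (simp_all add: m_def add_nonneg_pos)
  have fin: "gamma_norm (\<lambda>k. R (T *\<^sub>V k)) < \<infinity>" if "clinear R" "gamma_norm R < \<infinity>" for R :: "'h \<Rightarrow> 'x"
    using gamma_norm_compose_le[OF that(1) m] that(2) by (auto simp: ennreal_mult_less_top intro: le_less_trans)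
  have "\<exists>U\<in>finite_rank_ops. gamma_norm U < \<infinity> \<and> gamma_norm (\<lambda>k. S (T *\<^sub>V k) - U k) < \<epsilon>"
    if \<epsilon>: "\<epsilon> > 0" for \<epsilon>
  proof -
    have "\<epsilon> / ennreal m > 0" using \<epsilon> by (simp add: ennreal_zero_less_divide)
    from approx[OF this] obtain n g' x where U: "gamma_norm (tensor_sum n g' x :: 'h \<Rightarrow> 'x) < \<infinity>"
      and lt: "gamma_norm (\<lambda>h. S h - tensor_sum n g' x h) < \<epsilon> / ennreal m"
      by (auto simp: finite_rank_ops_def)
    have "clinear (\<lambda>h. S h - tensor_sum n g' x h)"
      using S(1) clinear_tensor_sum[of n g' x] by (simp add: clinear_def scaleC_diff_right)
    from gamma_norm_compose_le[OF this m]
    have "gamma_norm (\<lambda>k. S (T *\<^sub>V k) - tensor_sum n g' x (T *\<^sub>V k)) \<le>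
        ennreal m * gamma_norm (\<lambda>h. S h - tensor_sum n g' x h)" .
    also have "\<dots> < ennreal m * (\<epsilon> / ennreal m)"
      using lt m by (intro ennreal_mult_strict_left_mono) auto
    also have "\<dots> = \<epsilon>" using m by (simp add: ennreal_mult_divide_eq ennreal_times_divide mult.commute)
    finally have "gamma_norm (\<lambda>k. S (T *\<^sub>V k) - tensor_sum n g' x (T *\<^sub>V k)) < \<epsilon>" .
    moreover note fin[OF clinear_tensor_sum U]
    moreover have "(\<lambda>k. tensor_sum n g' x (T *\<^sub>V k)) \<in> finite_rank_ops"
      by (auto simp: finite_rank_ops_def tensor_sum_compose[abs_def])
    ultimately show ?thesis by (intro bexI[of _ "\<lambda>k. tensor_sum n g' x (T *\<^sub>V k)"]) auto
  qed
  moreover have "clinear (\<lambda>k. S (T *\<^sub>V k))"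
    using S(1) clinear_cblinfun_apply[of T] by (simp add: clinear_def)
  ultimately show ?thesis using fin[OF S] by (simp add: gamma_ops_def)
qed

text \<open>By trace duality the trace of \<open>V \<circ> T'\<close> against \<open>U\<close> is the trace of \<open>V\<close> against \<open>U \<circ> T\<close>, and up to
  the factor \<open>m\<close> the latter is an admissible test operator for \<open>V\<close>.\<close>

lemma gamma_dual_ops_compose:
  fixes V :: "'k::complex_inner cdual \<Rightarrow> 'x::complex_normed_vector cdual"
    and T :: "'k \<Rightarrow>\<^sub>C\<^sub>L 'h::complex_inner"
  assumes "V \<in> gamma_dual_ops"
  shows "(\<lambda>h'. V (transpose_op T *\<^sub>V h')) \<in> gamma_dual_ops"
proof -
  have V: "bounded_clinear V" "clinear V" "gamma_dual_norm V < \<infinity>"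
    using assms by (auto simp: gamma_dual_ops_def bounded_clinear_def)
  let ?W = "\<lambda>h'. V (transpose_op T *\<^sub>V h')"
  have W: "bounded_clinear ?W"
    using V(1) bounded_clinear_cblinfun_apply[of "transpose_op T"]
    unfolding bounded_clinear_iff
    by (simp add: bounded_linear_compose[of V "cblinfun_apply (transpose_op T)"] del: transpose_op_apply)
  define m where "m = norm T + 1"
  have m: "0 < m" "norm T \<le> m" by (simp_all add: m_def add_nonneg_pos)
  have "gamma_dual_norm ?W \<le> ennreal m * gamma_dual_norm V"
    unfolding gamma_dual_norm_def[of ?W]
  proof (rule SUP_least)
    fix U :: "'h \<Rightarrow> 'x"
    assume "U \<in> {U \<in> finite_rank_ops. gamma_norm U \<le> 1}"
    then obtain n g' x where U: "U = tensor_sum n g' x" "gamma_norm U \<le> 1"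
      by (auto simp: finite_rank_ops_def)
    let ?c = "complex_of_real (1 / m)"
    let ?U = "tensor_sum n (\<lambda>j. transpose_op T *\<^sub>V g' j) (\<lambda>j. ?c *\<^sub>C x j)"
    have "?U = (\<lambda>k. ?c *\<^sub>C U (T *\<^sub>V k))"
      by (simp add: fun_eq_iff U(1) tensor_sum_compose) (simp add: tensor_sum_def scaleC_sum_right scaleC_scaleC mult.commute)
    then have "gamma_norm ?U = ennreal (1 / m) * gamma_norm (\<lambda>k. U (T *\<^sub>V k))"
      using m by (simp only: gamma_norm_scaleC) (simp add: norm_divide)
    also have "\<dots> \<le> ennreal (1 / m) * (ennreal m * gamma_norm U)"
      using gamma_norm_compose_le[OF _ m, of U] clinear_tensor_sum U(1) by (intro mult_left_mono) auto
    also have "\<dots> = gamma_norm U"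
      using m by (simp add: mult.assoc[symmetric] ennreal_mult'[symmetric])
    finally have "gamma_norm ?U \<le> 1" using U(2) by simp
    then have "ennreal (cmod (trace_dual V ?U)) \<le> gamma_dual_norm V"
      unfolding gamma_dual_norm_def by (intro SUP_upper) (auto simp: finite_rank_ops_def)
    moreover have "trace_dual V ?U = ?c * trace_dual ?W U"
      using V(2) W by (simp add: U(1) trace_dual_tensor_sum bounded_clinear_def cblinfun_scaleC_right
          scaleC_complex_def sum_distrib_left del: transpose_op_apply)
    then have "cmod (trace_dual ?W U) = m * cmod (trace_dual V ?U)"
      using m by (simp add: norm_mult norm_divide)
    ultimately show "ennreal (cmod (trace_dual ?W U)) \<le> ennreal m * gamma_dual_norm V"
      using m by (simp add: ennreal_mult mult_left_mono)
  qed
  then have "gamma_dual_norm ?W < \<infinity>"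
    using V(3) by (auto simp: ennreal_mult_less_top intro: le_less_trans)
  then show ?thesis using W by (simp add: gamma_dual_ops_def)
qed

section \<open>Square functions of composed functions\<close>

lemma square_fun_compose:
  assumes "square_fun E \<Phi> g x = Some R"
  shows "square_fun E \<Phi> (cblinfun_apply (transpose_op T) \<circ> g) x = Some (R \<circ> cblinfun_apply T)"
proof -
  have dom: "\<forall>h. x \<in> dom (calc E \<Phi> (h \<diamondop>\<^sub>L g))" and
    R: "R = (\<lambda>h. the (calc E \<Phi> (h \<diamondop>\<^sub>L g) x))" "R \<in> gamma_ops"
    using assms by (auto simp: square_fun_def split: if_splits)
  then show ?thesis
    using gamma_ops_compose[OF R(2), of T] unfolding square_fun_def diamond_left_transpose
    using dom by (simp add: R(1) comp_def)
qed

lemma dual_square_fun_compose: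
  assumes "dual_square_fun E \<Phi> f x' = Some R"
  shows "dual_square_fun E \<Phi> (cblinfun_apply T \<circ> f) x' = Some (R \<circ> cblinfun_apply (transpose_op T))"
proof -
  have dom: "\<forall>h'. x' \<in> dom (transpose_partial (calc E \<Phi> (f \<diamondop>\<^sub>R h')))" and
    R: "R = (\<lambda>h'. the (transpose_partial (calc E \<Phi> (f \<diamondop>\<^sub>R h')) x'))" "R \<in> gamma_dual_ops"
    using assms by (auto simp: dual_square_fun_def split: if_splits)
  then show ?thesis
    using gamma_dual_ops_compose[OF R(2), of T] unfolding dual_square_fun_def diamond_right_comp
    using dom by (simp add: R(1) comp_def del: transpose_op_apply)
qed

lemma ran_square_fun: "ran (square_fun E \<Phi> f) \<subseteq> gamma_ops"
  by (auto simp: ran_def square_fun_def split: if_splits)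

lemma ran_dual_square_fun: "ran (dual_square_fun E \<Phi> f) \<subseteq> gamma_dual_ops"
  by (auto simp: ran_def dual_square_fun_def split: if_splits)

theorem theorem4p1:
  fixes E F :: "('o \<Rightarrow> complex) set"
    and \<Phi> :: "('o \<Rightarrow> complex) \<Rightarrow> ('x::cbanach \<Rightarrow>\<^sub>C\<^sub>L 'x)"
    and T :: "'k::chilbert_space \<Rightarrow>\<^sub>C\<^sub>L 'h::chilbert_space"
  assumes "functional_calculus E F \<Phi>"
  shows
    "(\<forall>g :: 'o \<Rightarrow> 'h cdual. g \<in> dual_valued F \<longrightarrow>
        cblinfun_apply (transpose_op T) \<circ> g \<in> dual_valued F \<and>
        dom (square_fun E \<Phi> g) \<subseteq> dom (square_fun E \<Phi> (cblinfun_apply (transpose_op T) \<circ> g)) \<and>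
        (\<forall>x\<in>dom (square_fun E \<Phi> g).
          the (square_fun E \<Phi> (cblinfun_apply (transpose_op T) \<circ> g) x) =
          the (square_fun E \<Phi> g x) \<circ> cblinfun_apply T) \<and>
        subordinate (square_fun E \<Phi> (cblinfun_apply (transpose_op T) \<circ> g)) (square_fun E \<Phi> g)) \<and>
     (\<forall>f :: 'o \<Rightarrow> 'k. f \<in> space_valued F \<longrightarrow>
        cblinfun_apply T \<circ> f \<in> space_valued F \<and>
        ((\<forall>k'. densely_defined (calc E \<Phi> (f \<diamondop>\<^sub>R k'))) \<longrightarrow>
          dom (dual_square_fun E \<Phi> f) \<subseteq> dom (dual_square_fun E \<Phi> (cblinfun_apply T \<circ> f)) \<and>
          (\<forall>x'\<in>dom (dual_square_fun E \<Phi> f).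
            the (dual_square_fun E \<Phi> (cblinfun_apply T \<circ> f) x') =
            the (dual_square_fun E \<Phi> f x') \<circ> cblinfun_apply (transpose_op T)) \<and>
          dual_subordinate (dual_square_fun E \<Phi> (cblinfun_apply T \<circ> f)) (dual_square_fun E \<Phi> f)))"
proof (intro conjI allI impI)
  fix g :: "'o \<Rightarrow> 'h cdual"
  assume g: "g \<in> dual_valued F"
  let ?Q = "square_fun E \<Phi> (cblinfun_apply (transpose_op T) \<circ> g)" and ?R = "square_fun E \<Phi> g"
  show "cblinfun_apply (transpose_op T) \<circ> g \<in> dual_valued F"
    using g unfolding dual_valued_def mem_Collect_eq diamond_left_transpose by blast
  show dom: "dom ?R \<subseteq> dom ?Q" by (blast dest: square_fun_compose)
  show eq: "\<forall>x\<in>dom ?R. the (?Q x) = the (?R x) \<circ> cblinfun_apply T"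
  proof
    fix x assume "x \<in> dom ?R"
    then obtain R where "?R x = Some R" by blast
    with square_fun_compose[OF this, of T] show "the (?Q x) = the (?R x) \<circ> cblinfun_apply T" by simp
  qed
  show "subordinate ?Q ?R"
    unfolding subordinate_def using dom eq by (intro conjI ran_square_fun exI[of _ T])
next
  fix f :: "'o \<Rightarrow> 'k"
  assume f: "f \<in> space_valued F"
  let ?Q = "dual_square_fun E \<Phi> (cblinfun_apply T \<circ> f)" and ?R = "dual_square_fun E \<Phi> f"
  show "cblinfun_apply T \<circ> f \<in> space_valued F"
    using f unfolding space_valued_def mem_Collect_eq diamond_right_comp by blast
  show dom: "dom ?R \<subseteq> dom ?Q" by (blast dest: dual_square_fun_compose)
  show eq: "\<forall>x'\<in>dom ?R. the (?Q x') = the (?R x') \<circ> cblinfun_apply (transpose_op T)"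
  proof
    fix x' assume "x' \<in> dom ?R"
    then obtain R where "?R x' = Some R" by blast
    with dual_square_fun_compose[OF this, of T] show "the (?Q x') = the (?R x') \<circ> cblinfun_apply (transpose_op T)" by simp
  qed
  show "dual_subordinate ?Q ?R"
    unfolding dual_subordinate_def using dom eq by (intro conjI ran_dual_square_fun exI[of _ "transpose_op T"])
qed

end
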